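(* Let $k$ be a natural number and let $T$ be a theory in-between $\mathsf{HA}$ and $\mathsf{PA}$. Then $T\vdash\mathrm{DNE}(\Pi_k\lor\Pi_k)$ if and only if $\mathrm{PNFT}_T(\mathrm{U}_{k'},\Pi_{k'})$ holds for all $k'\le k$.
   Context: $\mathsf{HA}$ is intuitionistic (Heyting) arithmetic in the language with function symbols for all primitive recursive functions and logical constants $\forall,\exists,\to,\land,\lor,\perp$; $\neg\varphi$ abbreviates $\varphi\to\perp$. $\mathsf{PA}$ is $\mathsf{HA}$ plus the law of excluded middle for all formulas. A theory $T$ is in-between $S$ and $S'$ if $T$ is a theory in the language of $\mathsf{HA}$ such that every theorem of $S$ is a theorem of $T$ and every theorem of $T$ is a theorem of $S'$. $T\vdash\mathrm{P}$ means every instance of schema $\mathrm{P}$ is provable in $T$. $\mathrm{FV}(\varphi)$ is the set of free variables. $\Sigma_0=\Pi_0$ are the quantifier-free formulas; $\Pi_{k+1}$: formulas $Q_1\bar x_1\cdots Q_{k+1}\bar x_{k+1}\varphi_{qf}$ ($\varphi_{qf}$ quantifier-free, $Q_i=\forall$ for odd $i$, $\exists$ for even $i$); $\Sigma_{k+1}$ likewise starting with $\exists$ (blocks may be empty by the paper's convention). $\Gamma(x)$: formulas of $\Gamma$ with free variables among $x$. $\mathrm{DNE}(\Gamma\lor\Gamma')$: $\forall x(\neg\neg(\varphi(x)\lor\psi(x))\to\varphi(x)\lor\psi(x))$ for $\varphi(x)\in\Gamma(x),\psi(x)\in\Gamma'(x)$. $\mathrm{PNFT}_T(\Gamma,\Gamma')$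 means: for every $\varphi\in\Gamma$ there is $\varphi'\in\Gamma'$ with $\mathrm{FV}(\varphi)=\mathrm{FV}(\varphi')$ and $T\vdash\varphi\leftrightarrow\varphi'$. Alternation paths: finite alternating sequences of $+,-$; $i(s)$ first symbol ($\times$ if empty), $s^\perp$ swaps signs, $l(s)$ length. $\mathrm{Alt}(\varphi)=\{\langle\rangle\}$ for quantifier-free $\varphi$; otherwise $\mathrm{Alt}(\neg\varphi_1)=\{s^\perp:s\in\mathrm{Alt}(\varphi_1)\}$, $\mathrm{Alt}(\varphi_1\land\varphi_2)=\mathrm{Alt}(\varphi_1\lor\varphi_2)=\mathrm{Alt}(\varphi_1)\cup\mathrm{Alt}(\varphi_2)$, $\mathrm{Alt}(\varphi_1\to\varphi_2)=\{s^\perp:s\in\mathrm{Alt}(\varphi_1)\}\cup\mathrm{Alt}(\varphi_2)$, $\mathrm{Alt}(\forall x\varphi_1)=\{s\in\mathrm{Alt}(\varphi_1):i(s)=-\}\cup\{-s:s\in\mathrm{Alt}(\varphi_1),i(s)\ne-\}$, $\mathrm{Alt}(\exists x\varphi_1)=\{s\in\mathrm{Alt}(\varphi_1):i(s)=+\}\cup\{+s:s\in\mathrm{Alt}(\varphi_1),i(s)\ne+\}$. $\deg\varphi=\max\{l(s):s\in\mathrm{Alt}(\varphi)\}$, $\mathrm{F}_k=\{\varphi:\deg\varphi=k\}$, $\mathrm{U}_0=\mathrm{F}_0$, $\mathrm{U}_{k+1}=\{\varphi\in\mathrm{F}_{k+1}: i(s)=-$ for all $s\in\mathrm{Alt}(\varphi)$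 with $l(s)=k+1\}$. *)

theory Defs
  imports Main
begin

section \<open>The language of Heyting arithmetic\<close>

text \<open>
  Codes of primitive recursive functions. As in Paulson's formalisation of primitive recursion, a
  code \<open>f\<close> denotes a function on argument lists of every length, where missing arguments are read
  as 0 and surplus ones are ignored. The \<open>n\<close>-ary function symbols of the language are the codes
  applied to lists of length \<open>n\<close>, so every primitive recursive function has a symbol, every
  symbol denotes a primitive recursive function, and every term of the datatype is well-formed.
\<close>

datatype pr =
    PZero
  | PSuc
  | PProj nat
  | PComp pr "pr list"
  | PRec pr pr

datatype tm = Var nat | Fn pr "tm list"

abbreviation Zero :: tm where "Zero \<equiv> Fn PZero []"
abbreviation Succ :: "tm \<Rightarrow> tm" where "Succ t \<equiv> Fn PSuc [t]"

text \<open>Formulas with de Bruijn indices: \<open>Var 0\<close> is the variable bound by the innermost quantifier.\<close>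

datatype fm =
    Eq tm tm
  | Bot
  | And fm fm
  | Or fm fm
  | Imp fm fm
  | All fm
  | Ex fm

abbreviation Neg :: "fm \<Rightarrow> fm" where "Neg p \<equiv> Imp p Bot"
abbreviation Iff :: "fm \<Rightarrow> fm \<Rightarrow> fm" where "Iff p q \<equiv> And (Imp p q) (Imp q p)"

primrec fv_tm :: "tm \<Rightarrow> nat set" where
  "fv_tm (Var n) = {n}"
| "fv_tm (Fn f ts) = \<Union> (set (map fv_tm ts))"

primrec FV :: "fm \<Rightarrow> nat set" where
  "FV (Eq s t) = fv_tm s \<union> fv_tm t"
| "FV Bot = {}"
| "FV (And p q) = FV p \<union> FV q"
| "FV (Or p q) = FV p \<union> FV q"
| "FV (Imp p q) = FV p \<union> FV q"
| "FV (All p) = {n. Suc n \<in> FV p}"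
| "FV (Ex p) = {n. Suc n \<in> FV p}"

primrec subst_tm :: "(nat \<Rightarrow> tm) \<Rightarrow> tm \<Rightarrow> tm" where
  "subst_tm \<sigma> (Var n) = \<sigma> n"
| "subst_tm \<sigma> (Fn f ts) = Fn f (map (subst_tm \<sigma>) ts)"

definition up :: "(nat \<Rightarrow> tm) \<Rightarrow> nat \<Rightarrow> tm" where
  "up \<sigma> = case_nat (Var 0) (\<lambda>n. subst_tm (\<lambda>m. Var (Suc m)) (\<sigma> n))"

primrec subst :: "(nat \<Rightarrow> tm) \<Rightarrow> fm \<Rightarrow> fm" where
  "subst \<sigma> (Eq s t) = Eq (subst_tm \<sigma> s) (subst_tm \<sigma> t)"
| "subst \<sigma> Bot = Bot"
| "subst \<sigma> (And p q) = And (subst \<sigma> p) (subst \<sigma> q)"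
| "subst \<sigma> (Or p q) = Or (subst \<sigma> p) (subst \<sigma> q)"
| "subst \<sigma> (Imp p q) = Imp (subst \<sigma> p) (subst \<sigma> q)"
| "subst \<sigma> (All p) = All (subst (up \<sigma>) p)"
| "subst \<sigma> (Ex p) = Ex (subst (up \<sigma>) p)"

definition shift :: "fm \<Rightarrow> fm" where
  "shift = subst (\<lambda>n. Var (Suc n))"

text \<open>\<open>inst t p\<close> is the result of removing the outermost binder of \<open>All p\<close> or \<open>Ex p\<close> and putting
  \<open>t\<close> for its variable.\<close>

definition inst :: "tm \<Rightarrow> fm \<Rightarrow> fm" where
  "inst t = subst (case_nat t Var)"


section \<open>Intuitionistic provability and the theories HA and PA\<close>

text \<open>
  Natural deduction for intuitionistic predicate logic with equality. \<open>T\<close> is the set of non-logical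
  axioms, \<open>G\<close> the list of open assumptions. The variable condition of the quantifier rules concerns
  \<open>G\<close> only, so an axiom with free variables stands for its universal closure.
\<close>

inductive derives :: "fm set \<Rightarrow> fm list \<Rightarrow> fm \<Rightarrow> bool" for T :: "fm set" where
  Axiom: "p \<in> T \<Longrightarrow> derives T G p"
| Assm: "p \<in> set G \<Longrightarrow> derives T G p"
| BotE: "derives T G Bot \<Longrightarrow> derives T G p"
| AndI: "derives T G p \<Longrightarrow> derives T G q \<Longrightarrow> derives T G (And p q)"
| AndE1: "derives T G (And p q) \<Longrightarrow> derives T G p"
| AndE2: "derives T G (And p q) \<Longrightarrow> derives T G q"
| OrI1: "derives T G p \<Longrightarrow> derives T G (Or p q)"
| OrI2: "derives T G q \<Longrightarrow> derives T G (Or p q)"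
| OrE: "derives T G (Or p q) \<Longrightarrow> derives T (p # G) r \<Longrightarrow> derives T (q # G) r \<Longrightarrow> derives T G r"
| ImpI: "derives T (p # G) q \<Longrightarrow> derives T G (Imp p q)"
| ImpE: "derives T G (Imp p q) \<Longrightarrow> derives T G p \<Longrightarrow> derives T G q"
| AllI: "derives T (map shift G) p \<Longrightarrow> derives T G (All p)"
| AllE: "derives T G (All p) \<Longrightarrow> derives T G (inst t p)"
| ExI: "derives T G (inst t p) \<Longrightarrow> derives T G (Ex p)"
| ExE: "derives T G (Ex p) \<Longrightarrow> derives T (p # map shift G) (shift q) \<Longrightarrow> derives T G q"
| EqI: "derives T G (Eq t t)"
| EqE: "derives T G (Eq s t) \<Longrightarrow> derives T G (inst s p) \<Longrightarrow> derives T G (inst t p)"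

abbreviation proves :: "fm set \<Rightarrow> fm \<Rightarrow> bool" (infix \<open>\<turnstile>\<close> 50) where
  "T \<turnstile> p \<equiv> derives T [] p"

definition proves_schema :: "fm set \<Rightarrow> fm set \<Rightarrow> bool" (infix \<open>\<tturnstile>\<close> 50) where
  "T \<tturnstile> P \<longleftrightarrow> (\<forall>p\<in>P. T \<turnstile> p)"

definition arg :: "nat \<Rightarrow> tm list \<Rightarrow> tm" where
  "arg i ts = (if i < length ts then ts ! i else Zero)"

text \<open>The premise \<open>p(S x)\<close> of induction is \<open>p\<close> with \<open>Succ (Var 0)\<close> for \<open>Var 0\<close>, in the scope of
  the same quantifier.\<close>

inductive_set HA :: "fm set" where
  Suc_inj: "Imp (Eq (Succ s) (Succ t)) (Eq s t) \<in> HA"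
| Suc_not_Zero: "Neg (Eq (Succ t) Zero) \<in> HA"
| Zero_def: "Eq (Fn PZero ts) Zero \<in> HA"
| Suc_def: "Eq (Fn PSuc ts) (Succ (arg 0 ts)) \<in> HA"
| Proj_def: "Eq (Fn (PProj i) ts) (arg i ts) \<in> HA"
| Comp_def: "Eq (Fn (PComp f gs) ts) (Fn f (map (\<lambda>g. Fn g ts) gs)) \<in> HA"
| Rec_Nil: "Eq (Fn (PRec g h) []) Zero \<in> HA"
| Rec_Zero: "Eq (Fn (PRec g h) (Zero # ts)) (Fn g ts) \<in> HA"
| Rec_Suc: "Eq (Fn (PRec g h) (Succ t # ts)) (Fn h (Fn (PRec g h) (t # ts) # t # ts)) \<in> HA"
| Induction: "Imp (inst Zero p)
    (Imp (All (Imp p (subst (case_nat (Succ (Var 0)) (\<lambda>n. Var (Suc n))) p))) (All p)) \<in> HA"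

definition PA :: "fm set" where
  "PA = HA \<union> {Or p (Neg p) | p. True}"

definition in_between :: "fm set \<Rightarrow> fm set \<Rightarrow> fm set \<Rightarrow> bool" where
  "in_between S S' T \<longleftrightarrow> (\<forall>p. S \<turnstile> p \<longrightarrow> T \<turnstile> p) \<and> (\<forall>p. T \<turnstile> p \<longrightarrow> S' \<turnstile> p)"


section \<open>Prenex classes and double negation elimination\<close>

primrec qf :: "fm \<Rightarrow> bool" where
  "qf (Eq s t) \<longleftrightarrow> True"
| "qf Bot \<longleftrightarrow> True"
| "qf (And p q) \<longleftrightarrow> qf p \<and> qf q"
| "qf (Or p q) \<longleftrightarrow> qf p \<and> qf q"
| "qf (Imp p q) \<longleftrightarrow> qf p \<and> qf q"
| "qf (All p) \<longleftrightarrow> False"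
| "qf (Ex p) \<longleftrightarrow> False"

fun Sigma_fm :: "nat \<Rightarrow> fm set" and Pi_fm :: "nat \<Rightarrow> fm set" where
  "Sigma_fm 0 = {p. qf p}"
| "Sigma_fm (Suc k) = {(Ex ^^ n) p | n p. p \<in> Pi_fm k}"
| "Pi_fm 0 = {p. qf p}"
| "Pi_fm (Suc k) = {(All ^^ n) p | n p. p \<in> Sigma_fm k}"

text \<open>The parameter variable of the schema is the one bound by the leading quantifier, hence the
  bound \<open>{0}\<close> on the free variables.\<close>

definition DNE_Or :: "fm set \<Rightarrow> fm set \<Rightarrow> fm set" where
  "DNE_Or \<Gamma> \<Gamma>' = {All (Imp (Neg (Neg (Or p q))) (Or p q)) | p q.
     p \<in> \<Gamma> \<and> FV p \<subseteq> {0} \<and> q \<in> \<Gamma>' \<and> FV q \<subseteq> {0}}"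

definition PNFT :: "fm set \<Rightarrow> fm set \<Rightarrow> fm set \<Rightarrow> bool" where
  "PNFT T \<Gamma> \<Gamma>' \<longleftrightarrow> (\<forall>p\<in>\<Gamma>. \<exists>p'\<in>\<Gamma>'. FV p = FV p' \<and> T \<turnstile> Iff p p')"


section \<open>Alternation paths and the classes F and U\<close>

datatype sign = Plus | Minus

type_synonym path = "sign list"

primrec flip :: "sign \<Rightarrow> sign" where
  "flip Plus = Minus"
| "flip Minus = Plus"

definition dual :: "path \<Rightarrow> path" where
  "dual s = map flip s"

text \<open>The first symbol of a path, with \<open>None\<close> in the role of the symbol \<open>\<times>\<close>.\<close>

definition init :: "path \<Rightarrow> sign option" where
  "init s = (case s of [] \<Rightarrow> None | x # _ \<Rightarrow> Some x)"

text \<open>Since \<open>Neg p\<close> is \<open>Imp p Bot\<close>, the clause for implication gives way to the one for negation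
  when the conclusion is \<open>Bot\<close>. On quantifier-free formulas the clauses yield the trivial path only,
  see \<open>Alt_qf\<close> below.\<close>

primrec Alt :: "fm \<Rightarrow> path set" where
  "Alt (Eq s t) = {[]}"
| "Alt Bot = {[]}"
| "Alt (And p q) = Alt p \<union> Alt q"
| "Alt (Or p q) = Alt p \<union> Alt q"
| "Alt (Imp p q) = (if q = Bot then dual ` Alt p else dual ` Alt p \<union> Alt q)"
| "Alt (All p) = {s \<in> Alt p. init s = Some Minus} \<union> {Minus # s | s. s \<in> Alt p \<and> init s \<noteq> Some Minus}"
| "Alt (Ex p) = {s \<in> Alt p. init s = Some Plus} \<union> {Plus # s | s. s \<in> Alt p \<and> init s \<noteq> Some Plus}"

lemma Alt_qf: "qf p \<Longrightarrow> Alt p = {[]}"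
  by (induction p) (auto simp: dual_def)

lemma finite_Alt: "finite (Alt p)"
  by (induction p) auto

lemma Alt_nonempty: "Alt p \<noteq> {}"
  by (induction p) auto

definition deg :: "fm \<Rightarrow> nat" where
  "deg p = Max (length ` Alt p)"

definition F_class :: "nat \<Rightarrow> fm set" where
  "F_class k = {p. deg p = k}"

fun U_class :: "nat \<Rightarrow> fm set" where
  "U_class 0 = F_class 0"
| "U_class (Suc k) = {p \<in> F_class (Suc k). \<forall>s\<in>Alt p. length s = Suc k \<longrightarrow> init s = Some Minus}"

end

theory Submission
  imports Defs
begin

text \<open>
  Assume DNE for \<open>\<Pi>\<^sub>k \<or> \<Pi>\<^sub>k\<close>. Then \<open>\<Sigma>\<^sub>j\<close> and \<open>\<Pi>\<^sub>j\<close> formulas with \<open>j < k\<close> are decidable, because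
  \<open>\<not>\<not>(p \<or> p\<^sup>\<bottom>)\<close> is provable for the prenex dual \<open>p\<^sup>\<bottom>\<close> of \<open>p\<close>. An induction on formulas shows
  simultaneously that formulas of type U have \<open>\<Pi>\<^sub>k\<close> equivalents and that negations of formulas of
  type E do; the propositional steps are classical equivalences that DNE for \<open>\<Pi>\<^sub>k \<or> \<Pi>\<^sub>k\<close> justifies.
  The schema has one parameter only, so a pairing function has to be verified in HA.

  Conversely, let \<open>p\<close> be \<open>\<Pi>\<^sub>k\<close>. Up to dummy quantifiers \<open>\<not>\<not>p\<close> is in U, hence equivalent in \<open>T\<close> to
  some \<open>\<Pi>\<^sub>k\<close> formula \<open>q\<close>, and PA proves \<open>q \<longrightarrow> p\<close>. This implication is already provable in \<open>T\<close>: strip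
  the leading universal quantifiers of \<open>p\<close> and apply the negative translation with the remaining
  formula \<open>D\<close> in the role of \<open>\<bottom>\<close> (Friedman's trick). A prenex formula implies its translation, and
  the translation of \<open>D\<close> implies \<open>D\<close> by the decidability available at the previous level. So \<open>\<Pi>\<^sub>k\<close>
  formulas are stable in \<open>T\<close>, and \<open>\<Pi>\<^sub>k \<or> \<Pi>\<^sub>k\<close> formulas, being in U, are equivalent to \<open>\<Pi>\<^sub>k\<close> formulas.
\<close>

section \<open>Substitution\<close>

lemma subst_tm_cong: "(\<And>n. n \<in> fv_tm t \<Longrightarrow> \<sigma> n = \<tau> n) \<Longrightarrow> subst_tm \<sigma> t = subst_tm \<tau> t"
  by (induction t) auto

lemma subst_tm_Var [simp]: "subst_tm Var t = t"
  by (induction t) (auto simp: map_idI)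

lemma subst_tm_subst_tm [simp]:
  "subst_tm \<sigma> (subst_tm \<tau> t) = subst_tm (\<lambda>n. subst_tm \<sigma> (\<tau> n)) t"
  by (induction t) auto

lemma up_simps [simp]:
  "up \<sigma> 0 = Var 0" "up \<sigma> (Suc n) = subst_tm (\<lambda>m. Var (Suc m)) (\<sigma> n)"
  by (auto simp: up_def)

lemma up_Var [simp]: "up Var = Var"
proof
  show "up Var n = Var n" for n by (cases n) auto
qed

lemma subst_tm_up: "(\<lambda>n. subst_tm (up \<sigma>) (up \<tau> n)) = up (\<lambda>n. subst_tm \<sigma> (\<tau> n))"
proof
  show "subst_tm (up \<sigma>) (up \<tau> n) = up (\<lambda>n. subst_tm \<sigma> (\<tau> n)) n" for n
    by (cases n) auto
qed

lemma subst_cong: "(\<And>n. n \<in> FV p \<Longrightarrow> \<sigma> n = \<tau> n) \<Longrightarrow> subst \<sigma> p = subst \<tau> p"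
proof (induction p arbitrary: \<sigma> \<tau>)
  case (All p)
  have "up \<sigma> n = up \<tau> n" if "n \<in> FV p" for n
    using All.prems that by (cases n) auto
  then show ?case by (simp add: All.IH[of "up \<sigma>" "up \<tau>"])
next
  case (Ex p)
  have "up \<sigma> n = up \<tau> n" if "n \<in> FV p" for n
    using Ex.prems that by (cases n) auto
  then show ?case by (simp add: Ex.IH[of "up \<sigma>" "up \<tau>"])
next
  case (Eq s t)
  have "subst_tm \<sigma> s = subst_tm \<tau> s" "subst_tm \<sigma> t = subst_tm \<tau> t"
    by (rule subst_tm_cong; simp add: Eq.prems)+
  then show ?case by simp
next
  case (And p q)
  have "subst \<sigma> p = subst \<tau> p" "subst \<sigma> q = subst \<tau> q"
    by (rule And.IH; simp add: And.prems)+
  then show ?case by simp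
next
  case (Or p q)
  have "subst \<sigma> p = subst \<tau> p" "subst \<sigma> q = subst \<tau> q"
    by (rule Or.IH; simp add: Or.prems)+
  then show ?case by simp
next
  case (Imp p q)
  have "subst \<sigma> p = subst \<tau> p" "subst \<sigma> q = subst \<tau> q"
    by (rule Imp.IH; simp add: Imp.prems)+
  then show ?case by simp
qed simp

lemma subst_Var [simp]: "subst Var p = p"
  by (induction p) auto

lemma subst_subst [simp]: "subst \<sigma> (subst \<tau> p) = subst (\<lambda>n. subst_tm \<sigma> (\<tau> n)) p"
  by (induction p arbitrary: \<sigma> \<tau>) (auto simp: subst_tm_up)

lemma fv_subst_tm: "fv_tm (subst_tm \<sigma> t) = (\<Union>n\<in>fv_tm t. fv_tm (\<sigma> n))"
  by (induction t) auto

text \<open>The quantifier cases of \<open>FV_subst\<close> come down to this: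
  \<open>up \<sigma>\<close> fixes the bound variable, so only the images of the other variables
  survive the unshifting.\<close>

lemma fv_up: "{n. \<exists>m\<in>A. Suc n \<in> fv_tm (up \<sigma> m)} = (\<Union>n\<in>{n. Suc n \<in> A}. fv_tm (\<sigma> n))"
proof (rule set_eqI)
  fix x
  have "Suc x \<in> fv_tm (up \<sigma> m) \<longleftrightarrow> (\<exists>n. m = Suc n \<and> x \<in> fv_tm (\<sigma> n))" for m
    by (cases m) (auto simp: fv_subst_tm)
  then show "x \<in> {n. \<exists>m\<in>A. Suc n \<in> fv_tm (up \<sigma> m)} \<longleftrightarrow> x \<in> (\<Union>n\<in>{n. Suc n \<in> A}. fv_tm (\<sigma> n))"
    by auto
qed

lemma FV_subst: "FV (subst \<sigma> p) = (\<Union>n\<in>FV p. fv_tm (\<sigma> n))"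
  by (induction p arbitrary: \<sigma>) (simp_all add: fv_subst_tm fv_up UN_Un)

lemma FV_shift [simp]: "FV (shift p) = Suc ` FV p"
  by (auto simp: shift_def FV_subst)

lemma finite_fv_tm: "finite (fv_tm t)"
  by (induction t) auto

lemma finite_FV: "finite (FV p)"
proof (induction p)
  case (All p)
  then have "finite (Suc -` FV p)" by (rule finite_vimageI) simp
  then show ?case by (simp add: vimage_def)
next
  case (Ex p)
  then have "finite (Suc -` FV p)" by (rule finite_vimageI) simp
  then show ?case by (simp add: vimage_def)
qed (auto simp: finite_fv_tm)

lemma FV_bounded: obtains N where "FV p \<subseteq> {..<N}"
proof
  show "FV p \<subseteq> {..<Suc (Max (FV p))}"
    using finite_FV[of p] by (auto simp: less_Suc_eq_le)
qed

lemma shift_simps [simp]: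
  "shift Bot = Bot"
  "shift (And p q) = And (shift p) (shift q)"
  "shift (Or p q) = Or (shift p) (shift q)"
  "shift (Imp p q) = Imp (shift p) (shift q)"
  by (auto simp: shift_def)

lemma inst_simps [simp]:
  "inst t Bot = Bot"
  "inst t (And p q) = And (inst t p) (inst t q)"
  "inst t (Or p q) = Or (inst t p) (inst t q)"
  "inst t (Imp p q) = Imp (inst t p) (inst t q)"
  by (auto simp: inst_def)

lemma inst_shift [simp]: "inst t (shift p) = p"
  by (simp add: inst_def shift_def)

lemma inst_subst_up: "inst t (subst (up \<sigma>) p) = subst (case_nat t \<sigma>) p"
proof -
  have "(\<lambda>n. subst_tm (case_nat t Var) (up \<sigma> n)) = case_nat t \<sigma>"
    by (auto simp: fun_eq_iff split: nat.splits)
  then show ?thesis by (simp add: inst_def)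
qed

lemma subst_shift: "subst (up \<sigma>) (shift p) = shift (subst \<sigma> p)"
  by (simp add: shift_def)


section \<open>Admissible rules\<close>

lemma weaken: "derives T G p \<Longrightarrow> set G \<subseteq> set G' \<Longrightarrow> derives T G' p"
proof (induction arbitrary: G' rule: derives.induct)
  case (OrE G p q r)
  have "derives T (p # G') r" "derives T (q # G') r" using OrE.prems
    by (auto intro!: OrE.IH(2)[of "p # G'"] OrE.IH(3)[of "q # G'"])
  with OrE show ?case by (blast intro: derives.OrE)
next
  case (ImpI p G q)
  then have "derives T (p # G') q" by (intro ImpI.IH) auto
  then show ?case by (rule derives.ImpI)
next
  case (AllI G p)
  then have "derives T (map shift G') p" by (intro AllI.IH) auto
  then show ?case by (rule derives.AllI)
next
  case (ExE G p q)
  have "derives T (p # map shift G') (shift q)"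
    using ExE.prems by (intro ExE.IH) auto
  with ExE show ?case by (blast intro: derives.ExE)
next
  case (Assm p G)
  then show ?case by (auto intro: derives.Assm)
next
  case Axiom
  then show ?case using derives.Axiom by metis
next
  case BotE
  then show ?case using derives.BotE by metis
next
  case AndI
  then show ?case using derives.AndI by metis
next
  case AndE1
  then show ?case using derives.AndE1 by metis
next
  case AndE2
  then show ?case using derives.AndE2 by metis
next
  case OrI1
  then show ?case using derives.OrI1 by metis
next
  case OrI2
  then show ?case using derives.OrI2 by metis
next
  case ImpE
  then show ?case using derives.ImpE by metis
next
  case AllE
  then show ?case using derives.AllE by metis
next
  case ExI
  then show ?case using derives.ExI by metis
next
  case EqI
  then show ?case using derives.EqI by metis
next
  case EqE
  then show ?case using derives.EqE by metis
qed

text \<open>With the later simp rules \<open>And_iff\<close>, \<open>All_iff\<close>,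
  \<open>And_left\<close>, \<open>Or_left\<close> and \<open>Ex_left\<close>, this makes the
  simplifier break down sequents by invertible rules. From left to right it is weakening followed by
  modus ponens.\<close>

lemma Imp_iff [simp]: "derives T G (Imp p q) \<longleftrightarrow> derives T (p # G) q"
proof
  assume "derives T G (Imp p q)"
  then have "derives T (p # G) (Imp p q)" by (rule weaken) auto
  then show "derives T (p # G) q" by (rule ImpE) (simp add: Assm)
qed (rule ImpI)

lemma cut: "derives T G p \<Longrightarrow> derives T (p # G) q \<Longrightarrow> derives T G q"
  by (rule ImpE[OF ImpI])

lemma theorem_weaken: "derives T [] p \<Longrightarrow> derives T G p"
  by (rule weaken) auto

section \<open>Closure of derivability under substitution\<close>

lemma All_power_subst:
  assumes "T \<turnstile> (All ^^ N) p" and "FV p \<subseteq> {..<N}"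
  shows "T \<turnstile> subst \<sigma> p"
  using assms
proof (induction N arbitrary: p \<sigma>)
  case 0
  then have "subst \<sigma> p = subst Var p" by (intro subst_cong) auto
  with 0 show ?case by simp
next
  case (Suc N)
  \<comment> \<open>The induction hypothesis instantiates all quantifiers but the innermost, which
    \<open>AllE\<close> then instantiates with \<open>\<sigma> 0\<close>.\<close>
  have "T \<turnstile> subst (\<sigma> \<circ> Suc) (All p)"
    using Suc by (intro Suc.IH) (auto simp: funpow_swap1)
  then have "T \<turnstile> inst (\<sigma> 0) (subst (up (\<sigma> \<circ> Suc)) p)"
    using AllE by simp
  moreover have "case_nat (\<sigma> 0) (\<sigma> \<circ> Suc) = \<sigma>"
    by (auto simp: fun_eq_iff split: nat.splits)
  ultimately show ?case by (simp add: inst_subst_up)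
qed

text \<open>Induction on derivations would get stuck at axioms, as \<open>T\<close> may fail to be
  closed under substitution. With no open assumptions, however, all free variables can be
  generalised and the closure instantiated again.\<close>

lemma theorem_subst:
  assumes "T \<turnstile> p"
  shows "T \<turnstile> subst \<sigma> p"
proof -
  obtain N where N: "FV p \<subseteq> {..<N}" by (rule FV_bounded)
  have "T \<turnstile> (All ^^ n) p" for n
    by (induction n) (use assms in \<open>simp_all add: AllI\<close>)
  then show ?thesis using N All_power_subst by blast
qed

text \<open>Moving the assumptions to the right as implications reduces this to
  \<open>theorem_subst\<close>.\<close>

lemma derives_subst: "derives T G p \<Longrightarrow> derives T (map (subst \<sigma>) G) (subst \<sigma> p)"
proof (induction G arbitrary: p)
  case Nil
  then show ?case using theorem_subst by simp
next
  case (Cons g G)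
  then have "derives T (map (subst \<sigma>) G) (subst \<sigma> (Imp g p))" by (intro Cons.IH) simp
  then show ?case by simp
qed

lemma derives_shift: "derives T G p \<Longrightarrow> derives T (map shift G) (shift p)"
  using derives_subst by (simp add: shift_def)

lemma inst_Var0_up [simp]: "inst (Var 0) (subst (up (\<lambda>n. Var (Suc n))) p) = p"
proof -
  have "case_nat (Var 0) (\<lambda>n. Var (Suc n)) = Var" by (auto simp: fun_eq_iff split: nat.splits)
  then show ?thesis by (simp add: inst_subst_up)
qed

text \<open>The eigenvariable form of elimination: instantiating the shifted quantifier with
  \<open>Var 0\<close> returns the body with its bound variable now free. \<open>ExI_shift\<close>
  is the counterpart for introduction.\<close>

lemma AllE_shift: "derives T G (shift (All p)) \<Longrightarrow> derives T G p"
  using AllE[of T G "subst (up (\<lambda>n. Var (Suc n))) p" "Var 0"] by (simp add: shift_def)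

lemma ExI_shift: "derives T G p \<Longrightarrow> derives T G (shift (Ex p))"
  using ExI[of T G "Var 0" "subst (up (\<lambda>n. Var (Suc n))) p"] by (simp add: shift_def)

lemma And_iff [simp]: "derives T G (And p q) \<longleftrightarrow> derives T G p \<and> derives T G q"
  by (metis AndI AndE1 AndE2)

lemma All_iff [simp]: "derives T G (All p) \<longleftrightarrow> derives T (map shift G) p"
  using AllI AllE_shift derives_shift by metis

lemma And_left [simp]: "derives T (And p q # G) r \<longleftrightarrow> derives T (p # q # G) r"
proof
  assume "derives T (And p q # G) r"
  then have "derives T (And p q # p # q # G) r" by (rule weaken) auto
  moreover have "derives T (p # q # G) (And p q)" by (simp add: Assm)
  ultimately show "derives T (p # q # G) r" using cut by metis
next
  assume *: "derives T (p # q # G) r"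
  have pq: "derives T (And p q # G) p" "derives T (And p q # G) q"
    using Assm[of "And p q" "And p q # G"] by (auto simp only: And_iff list.set_intros)
  from * have "derives T (p # q # And p q # G) r" by (rule weaken) auto
  then have "derives T (And p q # G) (Imp q (Imp p r))" by simp
  with pq show "derives T (And p q # G) r" using ImpE by metis
qed

lemma Or_left [simp]: "derives T (Or p q # G) r \<longleftrightarrow> derives T (p # G) r \<and> derives T (q # G) r"
proof safe
  assume *: "derives T (Or p q # G) r"
  have "derives T (Or p q # p # G) r" "derives T (Or p q # q # G) r"
    using * by (rule weaken, auto)+
  moreover have "derives T (p # G) (Or p q)" "derives T (q # G) (Or p q)"
    by (rule OrI1 OrI2, simp add: Assm)+
  ultimately show "derives T (p # G) r" "derives T (q # G) r" using cut by metis+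
next
  assume "derives T (p # G) r" "derives T (q # G) r"
  then have "derives T (p # Or p q # G) r" "derives T (q # Or p q # G) r"
    by - (rule weaken, assumption, auto)+
  then show "derives T (Or p q # G) r"
    by (rule OrE[rotated]) (simp add: Assm)
qed

lemma Ex_left [simp]: "derives T (Ex p # G) q \<longleftrightarrow> derives T (p # map shift G) (shift q)"
proof
  assume "derives T (Ex p # G) q"
  from derives_shift[OF this] have "derives T (shift (Ex p) # p # map shift G) (shift q)"
    by (rule weaken) auto
  moreover have "derives T (p # map shift G) (shift (Ex p))"
    by (rule ExI_shift) (simp add: Assm)
  ultimately show "derives T (p # map shift G) (shift q)" using cut by metis
next
  assume "derives T (p # map shift G) (shift q)"
  then have "derives T (p # map shift (Ex p # G)) (shift q)" by (rule weaken) auto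
  then show "derives T (Ex p # G) q"
    by (rule ExE[rotated]) (simp add: Assm)
qed

lemma Bot_left [simp]: "derives T (Bot # G) p"
  by (rule BotE) (simp add: Assm)

lemma Assm_Cons [simp]: "derives T (p # G) p"
  by (auto intro: Assm)

lemma cuts:
  assumes "\<And>h. h \<in> set H \<Longrightarrow> derives T G h" and "derives T H p"
  shows "derives T G p"
  using assms
proof (induction H arbitrary: p)
  case Nil
  show ?case by (rule theorem_weaken) (rule Nil.prems(2))
next
  case (Cons h H)
  have "derives T G (Imp h p)"
  proof (rule Cons.IH)
    show "derives T H (Imp h p)" using Cons.prems(2) by (rule ImpI)
  qed (rule Cons.prems(1), simp)
  then show ?case by (rule ImpE) (rule Cons.prems(1), simp)
qed

lemma mp_assm: "Imp p q \<in> set G \<Longrightarrow> derives T G p \<Longrightarrow> derives T G q"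
  by (rule ImpE[OF Assm])

lemma use_theorem: "T \<turnstile> Imp p q \<Longrightarrow> derives T G p \<Longrightarrow> derives T G q"
  by (rule ImpE[OF theorem_weaken])

lemma AllE_assm: "shift (All p) \<in> set G \<Longrightarrow> derives T G p"
  by (rule AllE_shift[OF Assm])

section \<open>Prenex formulas\<close>

lemma prenex_mono_step:
  "Sigma_fm m \<subseteq> Sigma_fm (Suc m)" "Pi_fm m \<subseteq> Pi_fm (Suc m)"
proof (induction m)
  case 0
  { case 1 show ?case by (auto intro!: exI[of _ "0::nat"]) }
  { case 2 show ?case by (auto intro!: exI[of _ "0::nat"]) }
next
  case (Suc m)
  { case 1 show ?case unfolding Sigma_fm.simps(2) using Suc by blast }
  { case 2 show ?case unfolding Pi_fm.simps(2) using Suc by blast }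
qed

lemma prenex_mono:
  assumes "m \<le> n" shows "Sigma_fm m \<subseteq> Sigma_fm n" "Pi_fm m \<subseteq> Pi_fm n"
  using assms by (induction rule: dec_induct) (use prenex_mono_step in blast)+

lemma Sigma_subset_Pi_Suc: "Sigma_fm m \<subseteq> Pi_fm (Suc m)"
proof
  fix p assume "p \<in> Sigma_fm m"
  then have "(All ^^ 0) p \<in> Pi_fm (Suc m)" unfolding Pi_fm.simps by blast
  then show "p \<in> Pi_fm (Suc m)" by simp
qed

lemma Pi_subset_Sigma_Suc: "Pi_fm m \<subseteq> Sigma_fm (Suc m)"
proof
  fix p assume "p \<in> Pi_fm m"
  then have "(Ex ^^ 0) p \<in> Sigma_fm (Suc m)" unfolding Sigma_fm.simps by blast
  then show "p \<in> Sigma_fm (Suc m)" by simp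
qed

lemma qf_in_prenex: "qf p \<Longrightarrow> p \<in> Sigma_fm m" "qf p \<Longrightarrow> p \<in> Pi_fm m"
  using prenex_mono[of 0 m] by auto

lemma Ex_in_Sigma: "p \<in> Sigma_fm (Suc m) \<Longrightarrow> Ex p \<in> Sigma_fm (Suc m)"
proof -
  assume "p \<in> Sigma_fm (Suc m)"
  then obtain n q where "p = (Ex ^^ n) q" "q \<in> Pi_fm m" by auto
  then have "Ex p = (Ex ^^ Suc n) q" "q \<in> Pi_fm m" by auto
  then show ?thesis unfolding Sigma_fm.simps by blast
qed

lemma All_in_Pi: "p \<in> Pi_fm (Suc m) \<Longrightarrow> All p \<in> Pi_fm (Suc m)"
proof -
  assume "p \<in> Pi_fm (Suc m)"
  then obtain n q where "p = (All ^^ n) q" "q \<in> Sigma_fm m" by auto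
  then have "All p = (All ^^ Suc n) q" "q \<in> Sigma_fm m" by auto
  then show ?thesis unfolding Pi_fm.simps by blast
qed

declare Sigma_fm.simps(2) [simp del] Pi_fm.simps(2) [simp del]

text \<open>The leading block is removed one quantifier at a time; once it is exhausted, a formula
  one level down remains.\<close>

lemma Sigma_Suc_induct [consumes 1, case_names Pi Ex]:
  assumes "p \<in> Sigma_fm (Suc m)"
    and "\<And>p. p \<in> Pi_fm m \<Longrightarrow> P p"
    and "\<And>p. p \<in> Sigma_fm (Suc m) \<Longrightarrow> P p \<Longrightarrow> P (Ex p)"
  shows "P p"
proof -
  from assms(1) obtain n q where p: "p = (Ex ^^ n) q" and q: "q \<in> Pi_fm m"
    by (auto simp: Sigma_fm.simps)
  have "(Ex ^^ n) q \<in> Sigma_fm (Suc m) \<and> P ((Ex ^^ n) q)"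
    by (induction n) (use q assms(2,3) Pi_subset_Sigma_Suc Ex_in_Sigma in auto)
  with p show ?thesis by simp
qed

lemma Pi_Suc_induct [consumes 1, case_names Sigma All]:
  assumes "p \<in> Pi_fm (Suc m)"
    and "\<And>p. p \<in> Sigma_fm m \<Longrightarrow> P p"
    and "\<And>p. p \<in> Pi_fm (Suc m) \<Longrightarrow> P p \<Longrightarrow> P (All p)"
  shows "P p"
proof -
  from assms(1) obtain n q where p: "p = (All ^^ n) q" and q: "q \<in> Sigma_fm m"
    by (auto simp: Pi_fm.simps)
  have "(All ^^ n) q \<in> Pi_fm (Suc m) \<and> P ((All ^^ n) q)"
    by (induction n) (use q assms(2,3) Sigma_subset_Pi_Suc All_in_Pi in auto)
  with p show ?thesis by simp
qed

text \<open>The induction descends through levels \<open>j \<le> m\<close>, while the cases keep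
  membership at the fixed level \<open>m\<close>. Thus a fact about level \<open>m\<close>, such as
  decidability, can be applied at every quantifier of the prefix.\<close>

lemma prenex_induct_aux:
  assumes "\<And>p. qf p \<Longrightarrow> P p"
    and "\<And>p. p \<in> Pi_fm m \<Longrightarrow> All p \<in> Pi_fm m \<Longrightarrow> P p \<Longrightarrow> P (All p)"
    and "\<And>p. p \<in> Sigma_fm m \<Longrightarrow> Ex p \<in> Sigma_fm m \<Longrightarrow> P p \<Longrightarrow> P (Ex p)"
  shows "j \<le> m \<Longrightarrow> (p \<in> Sigma_fm j \<longrightarrow> P p) \<and> (p \<in> Pi_fm j \<longrightarrow> P p)"
proof (induction j arbitrary: p)
  case 0
  then show ?case using assms(1) by auto
next
  case (Suc j)
  have IH: "q \<in> Sigma_fm j \<Longrightarrow> P q" "q \<in> Pi_fm j \<Longrightarrow> P q" for q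
    using Suc by auto
  have "P p" if "p \<in> Sigma_fm (Suc j)"
    using that
  proof (induction rule: Sigma_Suc_induct)
    case (Ex p)
    then show ?case using assms(3) Ex_in_Sigma prenex_mono(1)[OF Suc.prems] by blast
  qed (rule IH)
  moreover have "P p" if "p \<in> Pi_fm (Suc j)"
    using that
  proof (induction rule: Pi_Suc_induct)
    case (All p)
    then show ?case using assms(2) All_in_Pi prenex_mono(2)[OF Suc.prems] by blast
  qed (rule IH)
  ultimately show ?case by blast
qed

lemma prenex_induct [consumes 1, case_names qf All Ex]:
  assumes "p \<in> Sigma_fm m \<union> Pi_fm m"
    and "\<And>p. qf p \<Longrightarrow> P p"
    and "\<And>p. p \<in> Pi_fm m \<Longrightarrow> All p \<in> Pi_fm m \<Longrightarrow> P p \<Longrightarrow> P (All p)"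
    and "\<And>p. p \<in> Sigma_fm m \<Longrightarrow> Ex p \<in> Sigma_fm m \<Longrightarrow> P p \<Longrightarrow> P (Ex p)"
  shows "P p"
  using prenex_induct_aux[of P m m p] assms by auto

lemma qf_subst [simp]: "qf (subst \<sigma> p) = qf p"
  by (induction p arbitrary: \<sigma>) auto

lemma subst_prenex:
  "p \<in> Sigma_fm m \<Longrightarrow> subst \<sigma> p \<in> Sigma_fm m"
  "p \<in> Pi_fm m \<Longrightarrow> subst \<sigma> p \<in> Pi_fm m"
proof (induction m arbitrary: p \<sigma>)
  case 0
  { case 1 then show ?case by simp }
  { case 2 then show ?case by simp }
next
  case (Suc m)
  { case 1
    then show ?case
    proof (induction arbitrary: \<sigma> rule: Sigma_Suc_induct)
      case (Pi p)
      then show ?case using Suc Pi_subset_Sigma_Suc by blast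
    qed (simp del: Sigma_fm.simps add: Ex_in_Sigma) }
  { case 2
    then show ?case
    proof (induction arbitrary: \<sigma> rule: Pi_Suc_induct)
      case (Sigma p)
      then show ?case using Suc Sigma_subset_Pi_Suc by blast
    qed (simp del: Pi_fm.simps add: All_in_Pi) }
qed

lemma shift_prenex:
  "p \<in> Sigma_fm m \<Longrightarrow> shift p \<in> Sigma_fm m" "p \<in> Pi_fm m \<Longrightarrow> shift p \<in> Pi_fm m"
  by (simp_all add: shift_def subst_prenex)

text \<open>Negation is pushed through the quantifier prefix and then put in front of the matrix.
  The clauses for connectives do not recurse, because in a prenex formula these occur only inside
  the matrix.\<close>

primrec dual_fm :: "fm \<Rightarrow> fm" where
  "dual_fm (Eq s t) = Neg (Eq s t)"
| "dual_fm Bot = Neg Bot"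
| "dual_fm (And p q) = Neg (And p q)"
| "dual_fm (Or p q) = Neg (Or p q)"
| "dual_fm (Imp p q) = Neg (Imp p q)"
| "dual_fm (All p) = Ex (dual_fm p)"
| "dual_fm (Ex p) = All (dual_fm p)"

lemma dual_fm_qf: "qf p \<Longrightarrow> dual_fm p = Neg p"
  by (cases p) auto

lemma FV_dual_fm [simp]: "FV (dual_fm p) = FV p"
  by (induction p) auto

lemma dual_fm_prenex:
  "p \<in> Sigma_fm m \<Longrightarrow> dual_fm p \<in> Pi_fm m"
  "p \<in> Pi_fm m \<Longrightarrow> dual_fm p \<in> Sigma_fm m"
proof (induction m arbitrary: p)
  case 0
  { case 1 then show ?case by (simp add: dual_fm_qf) }
  { case 2 then show ?case by (simp add: dual_fm_qf) }
next
  case (Suc m)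
  { case 1
    then show ?case
    proof (induction rule: Sigma_Suc_induct)
      case (Pi p)
      then show ?case using Suc Sigma_subset_Pi_Suc by blast
    qed (simp add: All_in_Pi) }
  { case 2
    then show ?case
    proof (induction rule: Pi_Suc_induct)
      case (Sigma p)
      then show ?case using Suc Pi_subset_Sigma_Suc by blast
    qed (simp add: Ex_in_Sigma) }
qed

lemma Neg_contradiction: "derives T (Neg p # p # G) Bot"
  by (rule mp_assm[of p]) (simp, rule Assm, simp)

text \<open>This half of duality is intuitionistic. The other half, from \<open>Neg p\<close> to
  \<open>dual_fm p\<close>, relies on decidability; see \<open>Neg_dual_equiv\<close>.\<close>

lemma dual_fm_contradiction: "derives T (dual_fm p # p # G) Bot"
proof (induction p arbitrary: G)
  case (All p)
  have "derives T (dual_fm p # shift (All p) # map shift G) Bot"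
    by (rule cuts[OF _ All[of "map shift G"]]) (auto simp: Assm AllE_assm)
  then show ?case by simp
next
  case (Ex p)
  have "derives T (p # shift (All (dual_fm p)) # map shift G) Bot"
    by (rule cuts[OF _ Ex[of "map shift G"]]) (auto simp: Assm AllE_assm)
  then have "derives T (Ex p # All (dual_fm p) # G) Bot" by simp
  then show ?case by (rule weaken) auto
qed (simp_all only: dual_fm.simps Neg_contradiction)


section \<open>Double negation elimination and decidability\<close>

text \<open>Unlike in \<open>DNE_Or\<close>, any number of parameters may occur, so the schema can
  be applied to subformulas under quantifiers. \<open>DNE_at_iff\<close> relates the two
  versions.\<close>

definition DNE_at :: "fm set \<Rightarrow> nat \<Rightarrow> bool" where
  "DNE_at T k \<longleftrightarrow> (\<forall>p\<in>Pi_fm k. \<forall>q\<in>Pi_fm k. T \<turnstile> Imp (Neg (Neg (Or p q))) (Or p q))"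

text \<open>The second disjunct is the prenex dual instead of the negation, so that both disjuncts
  are prenex and the disjunction falls under the DNE schema one level up.\<close>

definition decides :: "fm set \<Rightarrow> nat \<Rightarrow> bool" where
  "decides T m \<longleftrightarrow> (\<forall>p\<in>Sigma_fm m \<union> Pi_fm m. T \<turnstile> Or p (dual_fm p))"

lemma DNE_at_mono: "DNE_at T k \<Longrightarrow> j \<le> k \<Longrightarrow> DNE_at T j"
  using prenex_mono(2) unfolding DNE_at_def by blast

lemma DNE_at_Or:
  assumes "DNE_at T k" "p \<in> Pi_fm k" "q \<in> Pi_fm k" "derives T (Neg (Or p q) # G) Bot"
  shows "derives T G (Or p q)"
proof -
  have "T \<turnstile> Imp (Neg (Neg (Or p q))) (Or p q)" using assms unfolding DNE_at_def by blast
  then show ?thesis by (rule use_theorem) (rule ImpI[OF assms(4)])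
qed

lemma Neg_Or_left [simp]:
  "derives T (Neg (Or p q) # G) r \<longleftrightarrow> derives T (Neg p # Neg q # G) r"
proof
  have "derives T (p # Neg p # Neg q # G) Bot" by (rule mp_assm[of p]) simp_all
  moreover have "derives T (q # Neg p # Neg q # G) Bot" by (rule mp_assm[of q]) simp_all
  ultimately show "derives T (Neg (Or p q) # G) r \<Longrightarrow> derives T (Neg p # Neg q # G) r"
    by (elim cuts[rotated]) (auto simp: Assm)
  have "derives T (p # Neg (Or p q) # G) Bot" "derives T (q # Neg (Or p q) # G) Bot"
    by (rule mp_assm[of "Or p q"], simp, rule OrI1 OrI2, simp)+
  then show "derives T (Neg p # Neg q # G) r \<Longrightarrow> derives T (Neg (Or p q) # G) r"
    by (elim cuts[rotated]) (auto simp: Assm)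
qed

text \<open>Once the body of a quantified formula is decided, refuting both the formula and its dual
  is contradictory. Since \<open>Sigma_fm m\<close> and \<open>Pi_fm m\<close> are contained in
  \<open>Pi_fm (Suc m)\<close>, the schema removes the resulting double negation.\<close>

lemma decides_DNE:
  assumes DNE: "DNE_at T (Suc m)" and dec: "decides T 0"
  shows "decides T m"
  unfolding decides_def
proof
  fix p assume "p \<in> Sigma_fm m \<union> Pi_fm m"
  then show "T \<turnstile> Or p (dual_fm p)"
  proof (induction rule: prenex_induct)
    case (qf p)
    then show ?case using dec unfolding decides_def by simp
  next
    case (All p)
    let ?G = "[Neg (All p), Neg (Ex (dual_fm p))]"
    \<comment> \<open>For a generic value the case \<open>dual_fm p\<close> would give the refuted
      existential formula, so \<open>p\<close> holds.\<close>
    have "derives T (map shift ?G) p"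
    proof (rule OrE[OF theorem_weaken[OF All.IH]])
      have "derives T (dual_fm p # map shift ?G) Bot"
        by (rule mp_assm[of "shift (Ex (dual_fm p))"]) (simp, rule ExI_shift, simp)
      then show "derives T (dual_fm p # map shift ?G) p" by (rule BotE)
    qed simp
    then have "derives T ?G (All p)" by simp
    then have "derives T ?G Bot" by (rule mp_assm[rotated]) simp
    moreover have "Ex (dual_fm p) \<in> Sigma_fm m" using dual_fm_prenex(2)[OF All.hyps(2)] by simp
    ultimately have "derives T [Neg (Or (All p) (Ex (dual_fm p)))] Bot"
      and "All p \<in> Pi_fm (Suc m)" "Ex (dual_fm p) \<in> Pi_fm (Suc m)"
      using All.hyps prenex_mono_step[of m] Sigma_subset_Pi_Suc[of m] by (simp, blast+)
    then show ?case unfolding dual_fm.simps by (intro DNE_at_Or[OF DNE])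
  next
    case (Ex p)
    let ?G = "[Neg (Ex p), Neg (All (dual_fm p))]"
    have "derives T (map shift ?G) (dual_fm p)"
    proof (rule OrE[OF theorem_weaken[OF Ex.IH]])
      have "derives T (p # map shift ?G) Bot"
        by (rule mp_assm[of "shift (Ex p)"]) (simp, rule ExI_shift, simp)
      then show "derives T (p # map shift ?G) (dual_fm p)" by (rule BotE)
    qed simp
    then have "derives T ?G (All (dual_fm p))" by simp
    then have "derives T ?G Bot" by (rule mp_assm[rotated]) simp
    moreover have "All (dual_fm p) \<in> Pi_fm m" using dual_fm_prenex(1)[OF Ex.hyps(2)] by simp
    ultimately have "derives T [Neg (Or (Ex p) (All (dual_fm p)))] Bot"
      and "Ex p \<in> Pi_fm (Suc m)" "All (dual_fm p) \<in> Pi_fm (Suc m)"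
      using Ex.hyps prenex_mono_step[of m] Sigma_subset_Pi_Suc[of m] by (simp, blast+)
    then show ?case unfolding dual_fm.simps by (intro DNE_at_Or[OF DNE])
  qed
qed

lemma decides_cases:
  assumes "decides T m" "p \<in> Sigma_fm m \<union> Pi_fm m"
    and "derives T (p # G) r" "derives T (dual_fm p # G) r"
  shows "derives T G r"
proof (rule OrE)
  show "derives T G (Or p (dual_fm p))"
    by (rule theorem_weaken) (use assms(1,2) in \<open>simp add: decides_def\<close>)
qed (fact assms)+

section \<open>Negative translation relative to a formula\<close>

text \<open>Double negation with \<open>D\<close> for falsity. \<open>nn_intro\<close> and
  \<open>nn_bind\<close> are the unit and the bind of the continuation monad.\<close>

abbreviation nn :: "fm \<Rightarrow> fm \<Rightarrow> fm" where
  "nn D p \<equiv> Imp (Imp p D) D"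

lemma nn_intro: "derives T G p \<Longrightarrow> derives T G (nn D p)"
  by (rule ImpI, rule mp_assm[of p], simp, erule weaken) auto

lemma nn_bind:
  assumes "derives T G (nn D p)" "derives T (p # G) (nn D q)"
  shows "derives T G (nn D q)"
proof (rule ImpI)
  have "derives T (p # Imp q D # G) (nn D q)"
    using assms(2) by (rule weaken) auto
  then have "derives T (p # Imp q D # G) D" by (rule ImpE) (rule Assm, simp)
  then have "derives T (Imp q D # G) (Imp p D)" by (rule ImpI)
  moreover have "derives T (Imp q D # G) (nn D p)" using assms(1) by (rule weaken) auto
  ultimately show "derives T (Imp q D # G) D" by (rule ImpE[rotated])
qed

lemma nn_map: "derives T G (nn D p) \<Longrightarrow> derives T (p # G) q \<Longrightarrow> derives T G (nn D q)"
  by (rule nn_bind, assumption, rule nn_intro)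

text \<open>The Goedel-Gentzen translation with \<open>D\<close> for falsity. Under a quantifier
  \<open>D\<close> is shifted, so that its variables are not captured.\<close>

primrec tr :: "fm \<Rightarrow> fm \<Rightarrow> fm" where
  "tr (Eq s t) D = nn D (Eq s t)"
| "tr Bot D = D"
| "tr (And p q) D = And (tr p D) (tr q D)"
| "tr (Or p q) D = nn D (Or (tr p D) (tr q D))"
| "tr (Imp p q) D = Imp (tr p D) (tr q D)"
| "tr (All p) D = All (tr p (shift D))"
| "tr (Ex p) D = nn D (Ex (tr p (shift D)))"

lemma tr_subst: "tr (subst \<sigma> p) (subst \<sigma> D) = subst \<sigma> (tr p D)"
  by (induction p arbitrary: \<sigma> D) (simp_all flip: subst_shift)

lemma tr_shift: "tr (shift p) (shift D) = shift (tr p D)"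
  by (simp add: shift_def tr_subst)

lemma tr_inst: "tr (inst t p) D = inst t (tr p (shift D))"
  using tr_subst[of "case_nat t Var" p "shift D"] inst_shift[of t D] by (simp add: inst_def)

text \<open>Translated formulas are stable relative to \<open>D\<close>. Hence, by
  \<open>tr_bind\<close>, a relative double negation among the premises may be dropped whenever the
  goal is a translation.\<close>

lemma nn_tr: "derives T G (nn D (tr p D)) \<Longrightarrow> derives T G (tr p D)"
proof (induction p arbitrary: G D)
  case (Eq s t)
  show ?case using Eq.prems unfolding tr.simps by (rule nn_bind) (rule Assm, simp)
next
  case Bot
  then show ?case unfolding tr.simps by (rule ImpE) simp
next
  case (And p q)
  have "derives T G (nn D (tr p D))" "derives T G (nn D (tr q D))"
    using And.prems[unfolded tr.simps] by (rule nn_map, simp add: Assm)+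
  then show ?case unfolding tr.simps And_iff using And.IH by blast
next
  case (Or p q)
  show ?case using Or.prems unfolding tr.simps by (rule nn_bind) (rule Assm, simp)
next
  case (Imp p q)
  have "derives T (tr p D # G) (nn D (Imp (tr p D) (tr q D)))"
    using Imp.prems[unfolded tr.simps] by (rule weaken) auto
  then have "derives T (tr p D # G) (nn D (tr q D))"
    by (rule nn_map) (rule mp_assm[of "tr p D"], simp, rule Assm, simp)
  then have "derives T (tr p D # G) (tr q D)" by (rule Imp.IH)
  then show ?case unfolding tr.simps by (rule ImpI)
next
  case (All p)
  have "derives T (map shift G) (nn (shift D) (shift (All (tr p (shift D)))))"
    using derives_shift[OF All.prems[unfolded tr.simps]] unfolding shift_simps .
  then have "derives T (map shift G) (nn (shift D) (tr p (shift D)))"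
    by (rule nn_map) (rule AllE_assm, simp)
  then have "derives T (map shift G) (tr p (shift D))" by (rule All.IH)
  then show ?case unfolding tr.simps by (rule AllI)
next
  case (Ex p)
  show ?case using Ex.prems unfolding tr.simps by (rule nn_bind) (rule Assm, simp)
qed

lemma tr_bind: "derives T G (nn D p) \<Longrightarrow> derives T (p # G) (tr q D) \<Longrightarrow> derives T G (tr q D)"
  by (rule nn_tr) (rule nn_map)

lemma tr_bottom: "derives T G D \<Longrightarrow> derives T G (tr p D)"
  by (rule nn_tr, rule ImpI, erule weaken) auto

lemma tr_axiom:
  assumes "p \<in> PA"
  shows "HA \<turnstile> tr p D"
proof -
  have eq: "HA \<turnstile> nn D (Eq s t)" if "Eq s t \<in> HA" for s t
    by (rule nn_intro) (rule Axiom[OF that])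
  have "HA \<turnstile> tr p D" if "p \<in> HA"
    using that
  proof cases
    case (Suc_inj s t)
    have "derives HA [nn D (Eq (Succ s) (Succ t))] (nn D (Eq s t))"
      by (rule nn_map[of _ _ "Eq (Succ s) (Succ t)"])
        (rule Assm, simp, rule use_theorem[OF Axiom[OF HA.Suc_inj]], simp)
    then show ?thesis unfolding Suc_inj tr.simps by (rule ImpI)
  next
    case (Suc_not_Zero t)
    have "derives HA [nn D (Eq (Succ t) Zero)] D"
      by (rule mp_assm[of "Imp (Eq (Succ t) Zero) D"], simp, rule ImpI, rule BotE)
        (rule use_theorem[OF Axiom[OF HA.Suc_not_Zero[of t]]], simp)
    then show ?thesis unfolding Suc_not_Zero tr.simps by (rule ImpI)
  next
    case (Induction q)
    let ?\<tau> = "case_nat (Succ (Var 0)) (\<lambda>n. Var (Suc n))"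
    \<comment> \<open>\<open>D\<close> does not depend on the induction variable, so the translation
      commutes with the successor substitution, and a translated induction axiom is the induction
      axiom for the translated formula.\<close>
    have "subst ?\<tau> (shift D) = shift D" by (simp add: shift_def)
    then have "tr (subst ?\<tau> q) (shift D) = subst ?\<tau> (tr q (shift D))"
      using tr_subst[of ?\<tau> q "shift D"] by simp
    then show ?thesis
      using Axiom[OF HA.Induction[of "tr q (shift D)"], of "[]"]
      unfolding Induction tr.simps tr_inst by (simp only:)
  qed (hypsubst, unfold tr.simps, rule eq, rule HA.intros)+
  moreover have "derives HA [] (tr (Or q (Neg q)) D)" for q
  proof -
    \<comment> \<open>The translation of \<open>Neg q\<close> is \<open>Imp (tr q D) D\<close>, so
      what remains is the usual proof that excluded middle is irrefutable, relative to
      \<open>D\<close>.\<close>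
    let ?G = "[Imp (Or (tr q D) (Imp (tr q D) D)) D]"
    have "derives HA (tr q D # ?G) D"
      by (rule mp_assm[of "Or (tr q D) (Imp (tr q D) D)"], simp, rule OrI1, simp)
    then have "derives HA ?G (Or (tr q D) (Imp (tr q D) D))"
      by (intro OrI2 ImpI)
    then have "derives HA ?G D"
      by (rule mp_assm[rotated]) simp
    then show ?thesis unfolding tr.simps by (rule ImpI)
  qed
  ultimately show ?thesis using assms unfolding PA_def by blast
qed

theorem tr_sound: "derives PA G p \<Longrightarrow> derives HA (map (\<lambda>g. tr g D) G) (tr p D)"
proof (induction arbitrary: D rule: derives.induct)
  case (Axiom p G)
  show ?case by (rule theorem_weaken) (rule tr_axiom[OF Axiom.hyps])
next
  case (Assm p G)
  then show ?case by (intro derives.Assm) simp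
next
  case (BotE G p)
  then show ?case by (intro tr_bottom) simp
next
  case (AndI G p q)
  then show ?case by simp
next
  case (AndE1 G p q)
  then show ?case by simp
next
  case (AndE2 G p q)
  then show ?case by simp
next
  case (OrI1 G p q)
  show ?case unfolding tr.simps by (rule nn_intro, rule derives.OrI1, rule OrI1.IH)
next
  case (OrI2 G q p)
  show ?case unfolding tr.simps by (rule nn_intro, rule derives.OrI2, rule OrI2.IH)
next
  case (OrE G p q r)
  have "derives HA (Or (tr p D) (tr q D) # map (\<lambda>g. tr g D) G) (tr r D)"
    using OrE.IH(2,3)[of D] by simp
  with OrE.IH(1)[of D, unfolded tr.simps] show ?case by (rule tr_bind)
next
  case (ImpI p G q)
  show ?case using ImpI.IH[of D] by simp
next
  case (ImpE G p q)
  show ?case by (rule derives.ImpE[OF ImpE.IH(1)[of D, unfolded tr.simps] ImpE.IH(2)])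
next
  case (AllI G p)
  show ?case using AllI.IH[of "shift D"] by (simp add: comp_def tr_shift)
next
  case (AllE G p t)
  show ?case unfolding tr_inst by (rule derives.AllE[OF AllE.IH[of D, unfolded tr.simps]])
next
  case (ExI G t p)
  show ?case unfolding tr.simps
    by (rule nn_intro, rule derives.ExI[of _ _ t]) (use ExI.IH[of D] in \<open>simp add: tr_inst\<close>)
next
  case (ExE G p q)
  have "derives HA (Ex (tr p (shift D)) # map (\<lambda>g. tr g D) G) (tr q D)"
    using ExE.IH(2)[of "shift D"] by (simp add: comp_def tr_shift)
  with ExE.IH(1)[of D, unfolded tr.simps] show ?case by (rule tr_bind)
next
  case (EqI G t)
  show ?case unfolding tr.simps by (rule nn_intro) (rule derives.EqI)
next
  case (EqE G s t p)
  let ?G = "map (\<lambda>g. tr g D) G"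
  have "derives HA (Eq s t # ?G) (inst s (tr p (shift D)))"
    by (rule weaken[OF EqE.IH(2)[of D, unfolded tr_inst]]) auto
  then have "derives HA (Eq s t # ?G) (tr (inst t p) D)"
    unfolding tr_inst by (rule derives.EqE[rotated]) simp
  with EqE.IH(1)[of D, unfolded tr.simps] show ?case by (rule tr_bind)
qed

text \<open>The halves are proved together, since an implication uses one for its premise and the
  other for its conclusion. In the second half the premise is decided: if it holds, only the
  conclusion is doubly negated; otherwise the implication is immediate.\<close>

lemma tr_qf:
  assumes "decides T 0"
  shows "qf p \<Longrightarrow> T \<turnstile> Imp p (tr p D)" "qf p \<Longrightarrow> T \<turnstile> Imp (tr p D) (nn D p)"
proof (induction p)
  case (Eq s t)
  { case 1 show ?case unfolding tr.simps by (rule ImpI, rule nn_intro) simp }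
  { case 2 show ?case unfolding tr.simps by (rule ImpI) (rule Assm, simp) }
next
  case Bot
  { case 1 show ?case by simp }
  { case 2 show ?case by (simp add: Assm) }
next
  case (And p q)
  { case 1
    then have qf: "qf p" "qf q" by auto
    have "derives T [p, q] (tr p D)" "derives T [p, q] (tr q D)"
      by (rule use_theorem[OF And.IH(1)[OF qf(1)]], simp)
        (rule use_theorem[OF And.IH(3)[OF qf(2)]], rule Assm, simp)
    then show ?case by simp }
  { case 2
    then have qf: "qf p" "qf q" by auto
    let ?G = "[tr p D, tr q D]"
    have "derives T ?G (nn D p)"
      by (rule use_theorem[OF And.IH(2)[OF qf(1)]]) simp
    then have "derives T ?G (nn D (And p q))"
    proof (rule nn_bind)
      have "derives T (p # ?G) (nn D q)"
        by (rule use_theorem[OF And.IH(4)[OF qf(2)]]) (rule Assm, simp)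
      then show "derives T (p # ?G) (nn D (And p q))"
        by (rule nn_map) (simp add: Assm)
    qed
    then have "derives T [And (tr p D) (tr q D)] (nn D (And p q))" unfolding And_left .
    then show ?case unfolding tr.simps by (rule ImpI) }
next
  case (Or p q)
  { case 1
    then have qf: "qf p" "qf q" by auto
    have "derives T [p] (Or (tr p D) (tr q D))" "derives T [q] (Or (tr p D) (tr q D))"
      by (rule OrI1, rule use_theorem[OF Or.IH(1)[OF qf(1)]], simp)
        (rule OrI2, rule use_theorem[OF Or.IH(3)[OF qf(2)]], simp)
    then have "derives T [Or p q] (Or (tr p D) (tr q D))" by simp
    then show ?case unfolding tr.simps by (intro ImpI[of _ "Or p q"] nn_intro) }
  { case 2
    then have qf: "qf p" "qf q" by auto
    let ?G = "[nn D (Or (tr p D) (tr q D))]"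
    have "derives T (tr p D # ?G) (nn D (Or p q))"
      by (rule nn_map, rule use_theorem[OF Or.IH(2)[OF qf(1)]], simp, rule OrI1, simp)
    moreover have "derives T (tr q D # ?G) (nn D (Or p q))"
      by (rule nn_map, rule use_theorem[OF Or.IH(4)[OF qf(2)]], simp, rule OrI2, simp)
    ultimately have "derives T (Or (tr p D) (tr q D) # ?G) (nn D (Or p q))"
      unfolding Or_left by (rule conjI)
    then have "derives T ?G (nn D (Or p q))"
      by (rule nn_bind[rotated]) (rule Assm, simp)
    then show ?case unfolding tr.simps by (rule ImpI) }
next
  case (Imp p q)
  { case 1
    then have qf: "qf p" "qf q" by auto
    let ?G = "[tr p D, Imp p q]"
    have "derives T (p # ?G) q"
      by (rule mp_assm[of p]) simp_all
    then have "derives T (p # ?G) (tr q D)"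
      by (rule use_theorem[OF Imp.IH(3)[OF qf(2)]])
    then have "derives T ?G (tr q D)"
      by (rule tr_bind[rotated]) (rule use_theorem[OF Imp.IH(2)[OF qf(1)]], simp)
    then show ?case by simp }
  { case 2
    then have qf: "qf p" "qf q" by auto
    let ?G = "[Imp (tr p D) (tr q D)]"
    have "derives T ?G (nn D (Imp p q))"
    proof (rule decides_cases[OF assms, of p])
      have "derives T (p # ?G) (tr q D)"
        by (rule mp_assm[of "tr p D"], simp) (rule use_theorem[OF Imp.IH(1)[OF qf(1)]], simp)
      then have "derives T (p # ?G) (nn D q)"
        by (rule use_theorem[OF Imp.IH(4)[OF qf(2)]])
      then show "derives T (p # ?G) (nn D (Imp p q))"
        by (rule nn_map) (rule ImpI, rule Assm, simp)
      have "derives T (p # Neg p # ?G) Bot"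
        by (rule mp_assm[of p]) simp_all
      then have "derives T (Neg p # ?G) (Imp p q)"
        by (rule ImpI[OF BotE])
      then show "derives T (dual_fm p # ?G) (nn D (Imp p q))"
        unfolding dual_fm_qf[OF qf(1)] by (rule nn_intro)
    qed (use qf in simp)
    then show ?case unfolding tr.simps by (rule ImpI) }
qed simp_all

text \<open>Both quantifiers are monotone, and implications occur only in the matrix; so deciding
  quantifier-free formulas suffices at every level.\<close>

lemma tr_prenex:
  assumes "decides T 0" "p \<in> Sigma_fm m \<union> Pi_fm m"
  shows "T \<turnstile> Imp p (tr p D)"
  using assms(2)
proof (induction arbitrary: D rule: prenex_induct)
  case (qf p)
  then show ?case by (rule tr_qf(1)[OF assms(1)])
next
  case (All p)
  have "derives T [shift (All p)] (tr p (shift D))"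
    by (rule use_theorem[OF All.IH]) (rule AllE_assm, simp)
  then show ?case by simp
next
  case (Ex p)
  have "derives T [p] (shift (Ex (tr p (shift D))))"
    by (rule ExI_shift) (rule use_theorem[OF Ex.IH], simp)
  then have "derives T [Ex p] (Ex (tr p (shift D)))" by simp
  then show ?case unfolding tr.simps by (intro ImpI[of _ "Ex p"] nn_intro)
qed

lemma tr_Ex_nn:
  assumes "T \<turnstile> Imp (tr p (shift D)) (nn (shift D) p)"
  shows "T \<turnstile> Imp (tr (Ex p) D) (nn D (Ex p))"
proof -
  let ?G = "[nn D (Ex (tr p (shift D)))]"
  have "derives T (tr p (shift D) # map shift ?G) (nn (shift D) (shift (Ex p)))"
    by (rule nn_map[OF use_theorem[OF assms]], simp, rule ExI_shift, simp)
  then have "derives T (Ex (tr p (shift D)) # ?G) (nn D (Ex p))"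
    unfolding Ex_left shift_simps .
  then have "derives T ?G (nn D (Ex p))"
    by (rule nn_bind[rotated]) (rule Assm, simp)
  then show ?thesis unfolding tr.simps by (rule ImpI)
qed

text \<open>The critical case is the universal one, where \<open>nn D\<close> would have to move out
  of the quantifier. Deciding the whole formula avoids this: either it holds, or a counterexample
  contradicts the doubly negated instance and thus yields \<open>D\<close>.\<close>

lemma tr_nn_prenex:
  assumes "decides T m" "decides T 0" "p \<in> Sigma_fm m \<union> Pi_fm m"
  shows "T \<turnstile> Imp (tr p D) (nn D p)"
  using assms(3)
proof (induction arbitrary: D rule: prenex_induct)
  case (qf p)
  then show ?case by (rule tr_qf(2)[OF assms(2)])
next
  case (All p)
  let ?G = "[All (tr p (shift D))]"
  have "derives T ?G (nn D (All p))"
  proof (rule decides_cases[OF assms(1), of "All p"])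
    show "derives T (All p # ?G) (nn D (All p))"
      by (rule nn_intro) (rule Assm, simp)
    have "derives T (dual_fm p # map shift ?G) (nn (shift D) (shift (All p)))"
    proof (rule nn_bind)
      show "derives T (dual_fm p # map shift ?G) (nn (shift D) p)"
        by (rule use_theorem[OF All.IH]) (rule AllE_assm, simp)
      have "derives T (p # dual_fm p # map shift ?G) Bot"
        by (rule weaken[OF dual_fm_contradiction[of T p "map shift ?G"]]) auto
      then show "derives T (p # dual_fm p # map shift ?G) (nn (shift D) (shift (All p)))"
        by (rule BotE)
    qed
    then show "derives T (dual_fm (All p) # ?G) (nn D (All p))"
      unfolding dual_fm.simps Ex_left shift_simps .
  qed (use All.hyps in simp)
  then show ?case unfolding tr.simps by (rule ImpI)
next
  case (Ex p)
  show ?case by (rule tr_Ex_nn[OF Ex.IH])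
qed

text \<open>A leading existential block commutes with \<open>nn D\<close> intuitionistically by
  \<open>tr_Ex_nn\<close>, so decidability one level below is enough.\<close>

lemma tr_nn_Sigma_Suc:
  assumes "decides T m" "decides T 0" "p \<in> Sigma_fm (Suc m)"
  shows "T \<turnstile> Imp (tr p D) (nn D p)"
  using assms(3)
proof (induction arbitrary: D rule: Sigma_Suc_induct)
  case (Pi p)
  then show ?case by (intro tr_nn_prenex[OF assms(1,2)]) simp
next
  case (Ex p)
  show ?case by (rule tr_Ex_nn[OF Ex.IH])
qed

text \<open>Leading universal quantifiers of \<open>p\<close> are stripped by weakening
  \<open>q\<close> to \<open>shift q\<close>. The remaining core lies in \<open>Sigma_fm m\<close>,
  which explains why decidability is assumed at the predecessor of \<open>m\<close>.\<close>

lemma conservation: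
  assumes HA: "\<forall>p. HA \<turnstile> p \<longrightarrow> T \<turnstile> p"
    and dec: "decides T 0" "\<And>j. m = Suc j \<Longrightarrow> decides T j"
    and p: "p \<in> Pi_fm (Suc m)" and q: "q \<in> Pi_fm k"
    and PA: "PA \<turnstile> Imp q p"
  shows "T \<turnstile> Imp q p"
  using p q PA
proof (induction arbitrary: q rule: Pi_Suc_induct)
  case (Sigma p)
  \<comment> \<open>Here \<open>D\<close> is chosen to be \<open>p\<close> itself, so that
    \<open>nn p p\<close> has the trivial premise \<open>Imp p p\<close> and delivers
    \<open>p\<close>.\<close>
  have nn: "T \<turnstile> Imp (tr p p) (nn p p)"
  proof (cases m)
    case 0
    then show ?thesis using tr_qf(2)[OF dec(1)] Sigma.hyps by simp
  next
    case (Suc j)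
    then show ?thesis by (intro tr_nn_Sigma_Suc[of T j]) (use dec Sigma.hyps in simp_all)
  qed
  have "derives HA [tr q p] (tr p p)" using tr_sound[of "[q]" p p] Sigma.prems by simp
  then have *: "T \<turnstile> Imp (tr q p) (tr p p)"
    by (intro HA[rule_format] ImpI)
  have "derives T [q] (tr q p)"
    by (rule use_theorem[OF tr_prenex[OF dec(1)]]) (use Sigma.prems in auto)
  then have "derives T [q] (nn p p)"
    by (intro use_theorem[OF nn] use_theorem[OF *])
  then have "derives T [q] p" by (rule ImpE) simp
  then show ?case by (rule ImpI)
next
  case (All p)
  have "T \<turnstile> Imp (shift q) p"
    by (rule All.IH) (use All.prems in \<open>auto intro: shift_prenex\<close>)
  then show ?case by simp
qed

section \<open>Arithmetic in HA\<close>

abbreviation lift :: "tm \<Rightarrow> tm" where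
  "lift t \<equiv> subst_tm (\<lambda>n. Var (Suc n)) t"

section \<open>Equality reasoning and induction\<close>

lemma Eq_sym: "derives T G (Eq s t) \<Longrightarrow> derives T G (Eq t s)"
  using EqE[of T G s t "Eq (Var 0) (lift s)"] by (simp add: inst_def EqI)

lemma Eq_trans: "derives T G (Eq s t) \<Longrightarrow> derives T G (Eq t u) \<Longrightarrow> derives T G (Eq s u)"
  using EqE[of T G t u "Eq (lift s) (Var 0)"] by (simp add: inst_def)

lemma Eq_cong_arg:
  "derives T G (Eq s t) \<Longrightarrow> derives T G (Eq (Fn f (xs @ s # ys)) (Fn f (xs @ t # ys)))"
  using EqE[of T G s t "Eq (Fn f (map lift (xs @ s # ys))) (Fn f (map lift xs @ Var 0 # map lift ys))"]
  by (simp add: inst_def EqI comp_def)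

lemma Eq_cong:
  assumes "list_all2 (\<lambda>s t. derives T G (Eq s t)) ss ts"
  shows "derives T G (Eq (Fn f ss) (Fn f ts))"
proof -
  have "derives T G (Eq (Fn f (xs @ ss)) (Fn f (xs @ ts)))" for xs
    using assms
  proof (induction ss ts arbitrary: xs rule: list_all2_induct)
    case Nil
    show ?case by (rule EqI)
  next
    case (Cons s ss t ts)
    have "derives T G (Eq (Fn f (xs @ s # ss)) (Fn f (xs @ t # ss)))"
      using Cons.hyps(1) by (rule Eq_cong_arg)
    then show ?case using Cons.IH[of "xs @ [t]"] by (simp add: Eq_trans)
  qed
  from this[of "[]"] show ?thesis by simp
qed

lemma HA_Proj: "i < length ts \<Longrightarrow> derives HA G (Eq (Fn (PProj i) ts) (ts ! i))"
  using Axiom[OF HA.Proj_def[of i ts]] by (simp add: arg_def)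

lemma HA_Comp:
  assumes "list_all2 (\<lambda>g u. derives HA G (Eq (Fn g ts) u)) gs us"
  shows "derives HA G (Eq (Fn (PComp f gs) ts) (Fn f us))"
  by (rule Eq_trans[OF Axiom[OF HA.Comp_def] Eq_cong]) (use assms in \<open>simp add: list_all2_map1\<close>)

lemma HA_induct:
  assumes "derives HA G (inst Zero p)"
    and "derives HA (p # map shift G) (subst (case_nat (Succ (Var 0)) (\<lambda>n. Var (Suc n))) p)"
  shows "derives HA G (All p)"
  by (rule ImpE[OF ImpE[OF Axiom[OF HA.Induction] assms(1)]], rule AllI, rule ImpI, rule assms(2))

lemma HA_induct_open:
  assumes "HA \<turnstile> inst Zero p"
    and "derives HA [p] (subst (case_nat (Succ (Var 0)) (\<lambda>n. Var (Suc n))) p)"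
  shows "HA \<turnstile> p"
  using HA_induct[of "[]" p] assms by simp

section \<open>Primitive recursive functions for Cantor's pairing\<close>

definition pr_add :: pr where
  "pr_add = PRec (PProj 0) (PComp PSuc [PProj 0])"

definition pr_pred :: pr where
  "pr_pred = PRec PZero (PProj (Suc 0))"

text \<open>Recursion is on the first argument, so the subtrahend comes first.\<close>

definition pr_sub :: pr where
  "pr_sub = PRec (PProj 0) (PComp pr_pred [PProj 0])"

text \<open>The step function receives the previous value, the predecessor and then the two
  branches, so index 3 selects the second branch.\<close>

definition pr_if_zero :: pr where
  "pr_if_zero = PRec (PProj 0) (PProj 3)"

text \<open>\<open>pr_tri\<close> maps \<open>n\<close> to the triangular number \<open>1 + 2 + \<dots> + (n + 1)\<close>, and \<open>pr_diag\<close> maps \<open>c\<close>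
  to the number of the diagonal that contains the \<open>c\<close>-th pair in Cantor's enumeration.\<close>

definition pr_tri :: pr where
  "pr_tri = PRec (PComp PSuc [PZero])
     (PComp pr_add [PComp PSuc [PProj (Suc 0)], PComp PSuc [PProj 0]])"

definition pr_diag :: pr where
  "pr_diag = PRec PZero (PComp pr_if_zero
     [PComp pr_sub [PComp PSuc [PProj (Suc 0)], PComp pr_tri [PProj 0]],
      PComp PSuc [PProj 0], PProj 0])"

abbreviation "Add s t \<equiv> Fn pr_add [s, t]"
abbreviation "Sub s t \<equiv> Fn pr_sub [s, t]"
abbreviation "Tri s \<equiv> Fn pr_tri [s]"
abbreviation "Diag s \<equiv> Fn pr_diag [s]"

lemma Proj_eqs:
  "derives HA G (Eq (Fn (PProj 0) (a # ts)) a)"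
  "derives HA G (Eq (Fn (PProj (Suc 0)) (a # b # ts)) b)"
  "derives HA G (Eq (Fn (PProj 3) (a # b # c # d # ts)) d)"
  using HA_Proj[of 0 "a # ts"] HA_Proj[of "Suc 0" "a # b # ts"] HA_Proj[of 3 "a # b # c # d # ts"]
  by (simp_all add: numeral_3_eq_3)

lemma Add_Zero: "derives HA G (Eq (Add Zero y) y)"
  unfolding pr_add_def by (rule Eq_trans[OF Axiom[OF HA.Rec_Zero] Proj_eqs(1)])

lemma Add_Suc: "derives HA G (Eq (Add (Succ x) y) (Succ (Add x y)))"
  unfolding pr_add_def
  by (rule Eq_trans[OF Axiom[OF HA.Rec_Suc] HA_Comp]) (simp add: Proj_eqs)

lemma pred_Suc: "derives HA G (Eq (Fn pr_pred [Succ x]) x)"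
  unfolding pr_pred_def by (rule Eq_trans[OF Axiom[OF HA.Rec_Suc] Proj_eqs(2)])

lemma Sub_Zero: "derives HA G (Eq (Sub Zero y) y)"
  unfolding pr_sub_def by (rule Eq_trans[OF Axiom[OF HA.Rec_Zero] Proj_eqs(1)])

lemma Sub_Suc: "derives HA G (Eq (Sub (Succ x) y) (Fn pr_pred [Sub x y]))"
  unfolding pr_sub_def
  by (rule Eq_trans[OF Axiom[OF HA.Rec_Suc] HA_Comp]) (simp add: Proj_eqs)

lemma if_zero_Zero: "derives HA G (Eq (Fn pr_if_zero [Zero, a, b]) a)"
  unfolding pr_if_zero_def by (rule Eq_trans[OF Axiom[OF HA.Rec_Zero] Proj_eqs(1)])

lemma if_zero_Suc: "derives HA G (Eq (Fn pr_if_zero [Succ x, a, b]) b)"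
  unfolding pr_if_zero_def by (rule Eq_trans[OF Axiom[OF HA.Rec_Suc] Proj_eqs(3)])

lemma Tri_Zero: "derives HA G (Eq (Tri Zero) (Succ Zero))"
  unfolding pr_tri_def
  by (rule Eq_trans[OF Axiom[OF HA.Rec_Zero] HA_Comp]) (simp add: EqI)

lemma Tri_Suc: "derives HA G (Eq (Tri (Succ n)) (Add (Succ n) (Succ (Tri n))))"
  unfolding pr_tri_def
  by (rule Eq_trans[OF Axiom[OF HA.Rec_Suc] HA_Comp]) (simp add: HA_Comp Proj_eqs)

lemma Diag_Zero: "derives HA G (Eq (Diag Zero) Zero)"
  unfolding pr_diag_def by (rule Axiom[OF HA.Rec_Zero])

lemma Diag_Suc:
  "derives HA G (Eq (Diag (Succ c))
     (Fn pr_if_zero [Sub (Succ c) (Tri (Diag c)), Succ (Diag c), Diag c]))"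
  unfolding pr_diag_def
  by (rule Eq_trans[OF Axiom[OF HA.Rec_Suc] HA_Comp]) (simp add: HA_Comp Proj_eqs)

lemma Eq_cong1: "derives T G (Eq s t) \<Longrightarrow> derives T G (Eq (Fn f [s]) (Fn f [t]))"
  by (rule Eq_cong) simp

lemma Eq_cong_first: "derives T G (Eq s t) \<Longrightarrow> derives T G (Eq (Fn f (s # us)) (Fn f (t # us)))"
  using Eq_cong_arg[of T G s t f "[]" us] by simp

lemma Eq_cong_second: "derives T G (Eq s t) \<Longrightarrow> derives T G (Eq (Fn f (u # s # us)) (Fn f (u # t # us)))"
  using Eq_cong_arg[of T G s t f "[u]" us] by simp

lemma Sub_Suc_Suc: "derives HA G (Eq (Sub (Succ y) (Succ z)) (Sub y z))"
proof -
  let ?p = "\<lambda>y z. Eq (Sub (Succ y) (Succ z)) (Sub y z)"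
  have "HA \<turnstile> ?p (Var 0) (Var (Suc 0))"
  proof (rule HA_induct_open)
    have "HA \<turnstile> ?p Zero z" for z
      by (rule Eq_trans[OF Sub_Suc], rule Eq_trans[OF Eq_cong1[OF Sub_Zero]],
          rule Eq_trans[OF pred_Suc], rule Eq_sym[OF Sub_Zero])
    then show "HA \<turnstile> inst Zero (?p (Var 0) (Var (Suc 0)))" by (simp add: inst_def)
    have "derives HA [?p y z] (?p (Succ y) z)" for y z
      by (rule Eq_trans[OF Sub_Suc], rule Eq_trans[OF Eq_cong1[OF Assm]], simp, rule Eq_sym[OF Sub_Suc])
    then show "derives HA [?p (Var 0) (Var (Suc 0))]
      (subst (case_nat (Succ (Var 0)) (\<lambda>n. Var (Suc n))) (?p (Var 0) (Var (Suc 0))))"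
      by simp
  qed
  from theorem_weaken[OF theorem_subst[OF this, of "case_nat y (case_nat z Var)"]]
  show ?thesis by simp
qed

lemma Add_Zero_right: "derives HA G (Eq (Add x Zero) x)"
proof -
  let ?p = "\<lambda>x. Eq (Add x Zero) x"
  have "HA \<turnstile> ?p (Var 0)"
  proof (rule HA_induct_open)
    show "HA \<turnstile> inst Zero (?p (Var 0))" by (simp add: inst_def Add_Zero)
    have "derives HA [?p x] (?p (Succ x))" for x
      by (rule Eq_trans[OF Add_Suc Eq_cong1[OF Assm]]) simp
    then show "derives HA [?p (Var 0)] (subst (case_nat (Succ (Var 0)) (\<lambda>n. Var (Suc n))) (?p (Var 0)))"
      by simp
  qed
  from theorem_weaken[OF theorem_subst[OF this, of "case_nat x Var"]]
  show ?thesis by simp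
qed

lemma Add_Suc_right: "derives HA G (Eq (Add x (Succ y)) (Succ (Add x y)))"
proof -
  let ?p = "\<lambda>x y. Eq (Add x (Succ y)) (Succ (Add x y))"
  have "HA \<turnstile> ?p (Var 0) (Var (Suc 0))"
  proof (rule HA_induct_open)
    have "HA \<turnstile> ?p Zero y" for y
      by (rule Eq_trans[OF Add_Zero Eq_cong1[OF Eq_sym[OF Add_Zero]]])
    then show "HA \<turnstile> inst Zero (?p (Var 0) (Var (Suc 0)))" by (simp add: inst_def)
    have "derives HA [?p x y] (?p (Succ x) y)" for x y
      by (rule Eq_trans[OF Add_Suc], rule Eq_trans[OF Eq_cong1[OF Assm]], simp,
          rule Eq_cong1[OF Eq_sym[OF Add_Suc]])
    then show "derives HA [?p (Var 0) (Var (Suc 0))]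
      (subst (case_nat (Succ (Var 0)) (\<lambda>n. Var (Suc n))) (?p (Var 0) (Var (Suc 0))))"
      by simp
  qed
  from theorem_weaken[OF theorem_subst[OF this, of "case_nat x (case_nat y Var)"]]
  show ?thesis by simp
qed

text \<open>Induction on the subtrahend \<open>y\<close>. This one cancellation law carries the
  verification of the pairing, without any theory of the order.\<close>

lemma Sub_Add: "derives HA G (Eq (Sub y (Add x y)) x)"
proof -
  let ?p = "\<lambda>y x. Eq (Sub y (Add x y)) x"
  have "HA \<turnstile> ?p (Var 0) (Var (Suc 0))"
  proof (rule HA_induct_open)
    have "HA \<turnstile> ?p Zero x" for x
      by (rule Eq_trans[OF Sub_Zero Add_Zero_right])
    then show "HA \<turnstile> inst Zero (?p (Var 0) (Var (Suc 0)))" by (simp add: inst_def)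
    have "derives HA [?p y x] (?p (Succ y) x)" for x y
      by (rule Eq_trans[OF Eq_cong_second[OF Add_Suc_right]], rule Eq_trans[OF Sub_Suc_Suc],
          rule Assm) simp
    then show "derives HA [?p (Var 0) (Var (Suc 0))]
      (subst (case_nat (Succ (Var 0)) (\<lambda>n. Var (Suc n))) (?p (Var 0) (Var (Suc 0))))"
      by simp
  qed
  from theorem_weaken[OF theorem_subst[OF this, of "case_nat y (case_nat x Var)"]]
  show ?thesis by simp
qed

text \<open>\<open>Visit n m\<close> says that the enumeration visits diagonal \<open>n\<close> with \<open>m\<close> pairs of it left to come.\<close>

definition Visit :: "tm \<Rightarrow> tm \<Rightarrow> fm" where
  "Visit n m = Ex (And (Eq (Diag (Var 0)) (lift n)) (Eq (Tri (lift n)) (Add (lift m) (Succ (Var 0)))))"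

lemma subst_Visit [simp]: "subst \<sigma> (Visit n m) = Visit (subst_tm \<sigma> n) (subst_tm \<sigma> m)"
  by (simp add: Visit_def)

lemma shift_Visit [simp]: "shift (Visit n m) = Visit (lift n) (lift m)"
  by (simp add: shift_def)

lemma inst_Visit [simp]:
  "inst t (Visit n m) = Visit (subst_tm (case_nat t Var) n) (subst_tm (case_nat t Var) m)"
  by (simp add: inst_def)

lemma VisitI:
  assumes "derives HA G (Eq (Diag c) n)" "derives HA G (Eq (Tri n) (Add m (Succ c)))"
  shows "derives HA G (Visit n m)"
  unfolding Visit_def by (rule ExI[of _ _ c]) (use assms in \<open>simp add: inst_def\<close>)

lemma VisitE:
  assumes "\<And>c. derives HA [Eq (Diag c) (lift n), Eq (Tri (lift n)) (Add (lift m) (Succ c))] (shift p)"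
  shows "HA \<turnstile> Imp (Visit n m) p"
  using assms[of "Var 0"] by (simp add: Visit_def)

lemma Visit_cong: "derives T G (Eq m m') \<Longrightarrow> derives T G (Visit n m) \<Longrightarrow> derives T G (Visit n m')"
  using EqE[of T G m m' "Visit (lift n) (Var 0)"] by simp

text \<open>The number of pairs left on the diagonal is computable from \<open>c\<close> alone. It
  is the number that the step function of \<open>pr_diag\<close> tests for zero.\<close>

lemma Sub_Tri_Diag:
  assumes "derives HA G (Eq (Diag c) n)" "derives HA G (Eq (Tri n) (Add m (Succ c)))"
  shows "derives HA G (Eq (Sub (Succ c) (Tri (Diag c))) m)"
proof -
  have "derives HA G (Eq (Tri (Diag c)) (Add m (Succ c)))"
    by (rule Eq_trans[OF Eq_cong1[OF assms(1)] assms(2)])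
  then show ?thesis by (rule Eq_trans[OF Eq_cong_second Sub_Add])
qed

lemma Visit_start: "HA \<turnstile> Visit Zero Zero"
  by (rule VisitI[OF Diag_Zero Eq_trans[OF Tri_Zero Eq_sym[OF Add_Zero]]])

text \<open>As long as pairs are left, the test in \<open>pr_diag\<close> fails and the successor of
  the current code stays on the diagonal.\<close>

lemma Visit_down: "HA \<turnstile> Imp (Visit n (Succ m)) (Visit n m)"
proof (rule VisitE)
  fix c
  let ?n = "lift n" and ?m = "lift m"
  let ?G = "[Eq (Diag c) ?n, Eq (Tri ?n) (Add (lift (Succ m)) (Succ c))]"
  have 1: "derives HA ?G (Eq (Diag c) ?n)" by simp
  have 2: "derives HA ?G (Eq (Tri ?n) (Add (Succ ?m) (Succ c)))" by (rule Assm) simp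
  have "derives HA ?G (Eq (Diag (Succ c)) (Diag c))"
    by (rule Eq_trans[OF Diag_Suc Eq_trans[OF Eq_cong_first[OF Sub_Tri_Diag[OF 1 2]] if_zero_Suc]])
  then have "derives HA ?G (Eq (Diag (Succ c)) ?n)" using 1 by (rule Eq_trans)
  moreover have "derives HA ?G (Eq (Tri ?n) (Add ?m (Succ (Succ c))))"
    by (rule Eq_trans[OF 2 Eq_trans[OF Add_Suc Eq_sym[OF Add_Suc_right]]])
  ultimately have "derives HA ?G (Visit ?n ?m)" by (rule VisitI)
  then show "derives HA ?G (shift (Visit n m))" by simp
qed

text \<open>With no pair left, the successor code opens the next diagonal. Diagonal
  \<open>n + 1\<close> has \<open>n + 2\<close> pairs, so \<open>n + 1\<close> are still to come
  after its first one.\<close>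

lemma Visit_next: "HA \<turnstile> Imp (Visit n Zero) (Visit (Succ n) (Succ n))"
proof (rule VisitE)
  fix c
  let ?n = "lift n"
  let ?G = "[Eq (Diag c) ?n, Eq (Tri ?n) (Add (lift Zero) (Succ c))]"
  have 1: "derives HA ?G (Eq (Diag c) ?n)" by simp
  have 2: "derives HA ?G (Eq (Tri ?n) (Add Zero (Succ c)))" by (rule Assm) simp
  have "derives HA ?G (Eq (Diag (Succ c)) (Succ (Diag c)))"
    by (rule Eq_trans[OF Diag_Suc Eq_trans[OF Eq_cong_first[OF Sub_Tri_Diag[OF 1 2]] if_zero_Zero]])
  then have "derives HA ?G (Eq (Diag (Succ c)) (Succ ?n))" using Eq_cong1[OF 1] by (rule Eq_trans)
  moreover have "derives HA ?G (Eq (Tri (Succ ?n)) (Add (Succ ?n) (Succ (Succ c))))"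
    by (rule Eq_trans[OF Tri_Suc Eq_cong_second[OF Eq_cong1[OF Eq_trans[OF 2 Add_Zero]]]])
  ultimately have "derives HA ?G (Visit (Succ ?n) (Succ ?n))" by (rule VisitI)
  then show "derives HA ?G (shift (Visit (Succ n) (Succ n)))" by simp
qed

lemma Visit_Add: "HA \<turnstile> Imp (Visit n (Add a b)) (Visit n b)"
proof -
  let ?p = "\<lambda>a b n. Imp (Visit n (Add a b)) (Visit n b)"
  let ?q = "?p (Var 0) (Var (Suc 0)) (Var (Suc (Suc 0)))"
  have "HA \<turnstile> ?q"
  proof (rule HA_induct_open)
    have "HA \<turnstile> ?p Zero b n" for b n
      by (rule ImpI) (rule Visit_cong[OF Add_Zero Assm], simp)
    then show "HA \<turnstile> inst Zero ?q" by (simp add: inst_def)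
    have "derives HA [?p a b n] (?p (Succ a) b n)" for a b n
      by (rule ImpI, rule mp_assm[of "Visit n (Add a b)"], simp, rule use_theorem[OF Visit_down],
          rule Visit_cong[OF Add_Suc Assm]) simp
    then show "derives HA [?q] (subst (case_nat (Succ (Var 0)) (\<lambda>n. Var (Suc n))) ?q)"
      by simp
  qed
  from theorem_subst[OF this, of "case_nat a (case_nat b (case_nat n Var))"]
  show ?thesis by simp
qed

text \<open>Every diagonal is entered at its first pair: from there \<open>Visit_Add\<close> goes
  down to its last pair, and \<open>Visit_next\<close> moves on.\<close>

lemma Visit_diagonal: "HA \<turnstile> Visit n n"
proof -
  have "HA \<turnstile> Visit (Var 0) (Var 0)"
  proof (rule HA_induct_open)
    show "HA \<turnstile> inst Zero (Visit (Var 0) (Var 0))" using Visit_start by simp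
    have "derives HA [Visit n n] (Visit (Succ n) (Succ n))" for n
      by (rule use_theorem[OF Visit_next], rule use_theorem[OF Visit_Add],
          rule Visit_cong[OF Eq_sym[OF Add_Zero_right] Assm]) simp
    then show "derives HA [Visit (Var 0) (Var 0)]
      (subst (case_nat (Succ (Var 0)) (\<lambda>n. Var (Suc n))) (Visit (Var 0) (Var 0)))" by simp
  qed
  from theorem_subst[OF this, of "case_nat n Var"] show ?thesis by simp
qed

text \<open>The pair of \<open>a\<close> and \<open>b\<close> sits on diagonal \<open>a + b\<close>
  where \<open>b\<close> pairs are left. So the second component is that remainder, and the first is
  the diagonal number minus it.\<close>

abbreviation "Unpair2 c \<equiv> Sub (Succ c) (Tri (Diag c))"
abbreviation "Unpair1 c \<equiv> Sub (Unpair2 c) (Diag c)"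

text \<open>The code is found by entering diagonal \<open>a + b\<close> at its start and going
  \<open>a\<close> steps down, to where \<open>b\<close> pairs are left.\<close>

lemma HA_pairing:
  "HA \<turnstile> Ex (And (Eq (Unpair1 (Var 0)) (lift a)) (Eq (Unpair2 (Var 0)) (lift b)))"
    (is "HA \<turnstile> ?P")
proof -
  have "HA \<turnstile> Imp (Visit (Add a b) b) ?P"
  proof (rule VisitE)
    fix c
    let ?n = "lift (Add a b)"
    let ?G = "[Eq (Diag c) ?n, Eq (Tri ?n) (Add (lift b) (Succ c))]"
    have 1: "derives HA ?G (Eq (Diag c) ?n)" by simp
    have 2: "derives HA ?G (Eq (Tri ?n) (Add (lift b) (Succ c)))" by (rule Assm) simp
    have U2: "derives HA ?G (Eq (Unpair2 c) (lift b))" by (rule Sub_Tri_Diag[OF 1 2])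
    have "derives HA ?G (Eq (Unpair1 c) (Sub (lift b) ?n))"
      by (rule Eq_trans[OF Eq_cong_first[OF U2] Eq_cong_second[OF 1]])
    then have U1: "derives HA ?G (Eq (Unpair1 c) (lift a))"
      by (rule Eq_trans) (simp add: Sub_Add)
    show "derives HA ?G (shift ?P)"
      unfolding shift_def subst.simps
      by (rule ExI[of _ _ c]) (use U1 U2 in \<open>simp add: inst_def\<close>)
  qed
  then show ?thesis
    by (rule use_theorem) (rule use_theorem[OF Visit_Add Visit_diagonal])
qed

section \<open>Decidability of quantifier-free formulas\<close>

lemma Eq_decidable: "HA \<turnstile> Or (Eq s t) (Neg (Eq s t))"
proof -
  let ?d = "\<lambda>s t. Or (Eq s t) (Neg (Eq s t))"
  \<comment> \<open>Outer induction on \<open>s\<close> with \<open>t\<close> universally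
    quantified. The inner induction on \<open>t\<close> serves as a case distinction: its successor
    step uses the outer hypothesis.\<close>
  let ?p = "All (?d (Var (Suc 0)) (Var 0))"
  have Suc_Zero: "derives HA G (?d (Succ t) Zero)" for G t
    by (rule OrI2, rule theorem_weaken, rule Axiom, rule HA.Suc_not_Zero)
  have Zero_Suc: "derives HA G (?d Zero (Succ t))" for G t
    by (rule OrI2, rule ImpI, rule use_theorem[OF Axiom[OF HA.Suc_not_Zero[of t]]],
        rule Eq_sym) simp
  have Suc_Suc: "derives HA G (?d (Succ s) (Succ t))" if "derives HA G (?d s t)" for G s t
  proof (rule OrE[OF that])
    show "derives HA (Eq s t # G) (?d (Succ s) (Succ t))"
      by (rule OrI1, rule Eq_cong1) simp
    show "derives HA (Neg (Eq s t) # G) (?d (Succ s) (Succ t))"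
      by (rule OrI2, rule ImpI, rule mp_assm[of "Eq s t"], simp)
        (rule use_theorem[OF Axiom[OF HA.Suc_inj]], simp)
  qed
  have "HA \<turnstile> ?p"
  proof (rule HA_induct_open)
    have "HA \<turnstile> All (?d Zero (Var 0))"
      by (rule HA_induct) (simp_all add: inst_def Zero_Suc OrI1 EqI)
    then show "HA \<turnstile> inst Zero ?p" by (simp add: inst_def)
    have "derives HA [?p] (All (?d (Succ (Var (Suc 0))) (Var 0)))"
    proof (rule HA_induct)
      show "derives HA [?p] (inst Zero (?d (Succ (Var (Suc 0))) (Var 0)))"
        using Suc_Zero[of "[?p]" "Var 0"] by (simp add: inst_def)
      let ?G = "?d (Succ (Var (Suc 0))) (Var 0) # map shift [?p]"
      have "derives HA ?G (shift ?p)" by (rule Assm) simp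
      then have "derives HA ?G (All (?d (Var (Suc (Suc 0))) (Var 0)))"
        unfolding shift_def by (simp only: subst.simps subst_tm.simps up_simps)
      from AllE[OF this, of "Var 0"] have "derives HA ?G (?d (Var (Suc 0)) (Var 0))"
        by (simp only: inst_def subst.simps subst_tm.simps nat.case)
      from Suc_Suc[OF this]
      show "derives HA ?G (subst (case_nat (Succ (Var 0)) (\<lambda>n. Var (Suc n)))
          (?d (Succ (Var (Suc 0))) (Var 0)))"
        by (simp only: subst.simps subst_tm.simps nat.case list.map)
    qed
    then show "derives HA [?p] (subst (case_nat (Succ (Var 0)) (\<lambda>n. Var (Suc n))) ?p)"
      by (simp only: subst.simps subst_tm.simps up_simps nat.case list.map)
  qed
  then have "HA \<turnstile> ?d (Var (Suc 0)) (Var 0)" by (simp only: All_iff list.map)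
  from theorem_subst[OF this, of "case_nat t (case_nat s Var)"] show ?thesis by simp
qed

lemma qf_decidable: "qf p \<Longrightarrow> HA \<turnstile> Or p (Neg p)"
proof (induction p)
  case (Eq s t)
  show ?case by (rule Eq_decidable)
next
  case Bot
  show ?case by (rule OrI2) simp
next
  case (And p q)
  have p: "derives HA G (Or p (Neg p))" and q: "derives HA G (Or q (Neg q))" for G
    by (rule theorem_weaken, use And in simp)+
  show ?case
  proof (rule OrE[OF p])
    show "derives HA [p] (Or (And p q) (Neg (And p q)))"
    proof (rule OrE[OF q])
      show "derives HA [q, p] (Or (And p q) (Neg (And p q)))"
        by (rule OrI1) (simp add: Assm)
      show "derives HA [Neg q, p] (Or (And p q) (Neg (And p q)))"
        by (rule OrI2, unfold Imp_iff And_left) (rule mp_assm[of q], simp, rule Assm, simp)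
    qed
    show "derives HA [Neg p] (Or (And p q) (Neg (And p q)))"
      by (rule OrI2, unfold Imp_iff And_left) (rule mp_assm[of p], simp, rule Assm, simp)
  qed
next
  case (Or p q)
  have p: "derives HA G (Or p (Neg p))" and q: "derives HA G (Or q (Neg q))" for G
    by (rule theorem_weaken, use Or in simp)+
  show ?case
  proof (rule OrE[OF p])
    show "derives HA [p] (Or (Or p q) (Neg (Or p q)))"
      by (rule OrI1, rule OrI1) simp
    show "derives HA [Neg p] (Or (Or p q) (Neg (Or p q)))"
    proof (rule OrE[OF q])
      show "derives HA [q, Neg p] (Or (Or p q) (Neg (Or p q)))"
        by (rule OrI1, rule OrI2) simp
      have "derives HA [p, Neg q, Neg p] Bot" by (rule mp_assm[of p]) simp_all
      moreover have "derives HA [q, Neg q, Neg p] Bot" by (rule mp_assm[of q]) simp_all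
      ultimately show "derives HA [Neg q, Neg p] (Or (Or p q) (Neg (Or p q)))"
        by (intro OrI2) simp
    qed
  qed
next
  case (Imp p q)
  have p: "derives HA G (Or p (Neg p))" and q: "derives HA G (Or q (Neg q))" for G
    by (rule theorem_weaken, use Imp in simp)+
  show ?case
  proof (rule OrE[OF q])
    show "derives HA [q] (Or (Imp p q) (Neg (Imp p q)))"
      by (rule OrI1, rule ImpI, rule Assm) simp
    show "derives HA [Neg q] (Or (Imp p q) (Neg (Imp p q)))"
    proof (rule OrE[OF p])
      show "derives HA [p, Neg q] (Or (Imp p q) (Neg (Imp p q)))"
        by (rule OrI2, rule ImpI, rule mp_assm[of q], simp, rule mp_assm[of p]) (simp_all add: Assm)
      show "derives HA [Neg p, Neg q] (Or (Imp p q) (Neg (Imp p q)))"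
        by (rule OrI1, rule ImpI, rule BotE, rule mp_assm[of p]) simp_all
    qed
  qed
qed simp_all

lemma decides_0:
  assumes "\<forall>p. HA \<turnstile> p \<longrightarrow> T \<turnstile> p"
  shows "decides T 0"
  unfolding decides_def by (auto simp: dual_fm_qf intro!: assms[rule_format] qf_decidable)


section \<open>Several parameters\<close>

text \<open>Every pair of values has a code \<open>c\<close> by \<open>HA_pairing\<close>. The
  assumed theorem gives \<open>p\<close> at the components of \<open>c\<close>, and Leibniz's rule
  replaces these by the two original variables.\<close>

lemma merge_parameters:
  assumes HA: "\<forall>p. HA \<turnstile> p \<longrightarrow> T \<turnstile> p"
    and "T \<turnstile> subst (case_nat (Unpair1 (Var 0)) (case_nat (Unpair2 (Var 0)) (\<lambda>n. Var (Suc n)))) p"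
  shows "T \<turnstile> p"
proof -
  \<comment> \<open>\<open>\<rho>\<close> fills the first two places and shifts the other variables
    by one, making room for the eigenvariable of the code. \<open>?\<tau>\<close> renames the other
    parameters of the assumed theorem to match.\<close>
  define \<rho> where "\<rho> a b = case_nat a (case_nat b (\<lambda>n. Var (Suc (Suc (Suc n)))))" for a b
  let ?\<tau> = "case_nat (Var 0) (\<lambda>n. Var (Suc (Suc (Suc n))))"
  let ?E = "\<lambda>c. And (Eq (Unpair1 c) (Var (Suc 0))) (Eq (Unpair2 c) (Var (Suc (Suc 0))))"
  have replace1: "derives T G (subst (\<rho> a' b) p)"
    if "derives T G (subst (\<rho> a b) p)" "derives T G (Eq a a')" for G a a' b
  proof -
    have "subst (\<rho> a b) p = inst a (subst (case_nat (Var 0) (case_nat (lift b)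
        (\<lambda>n. Var (Suc (Suc (Suc (Suc n))))))) p)" for a
      unfolding inst_def subst_subst by (rule subst_cong) (auto simp: \<rho>_def split: nat.splits)
    with that show ?thesis by (metis EqE)
  qed
  have replace2: "derives T G (subst (\<rho> a b') p)"
    if "derives T G (subst (\<rho> a b) p)" "derives T G (Eq b b')" for G a b b'
  proof -
    have "subst (\<rho> a b) p = inst b (subst (case_nat (lift a) (case_nat (Var 0)
        (\<lambda>n. Var (Suc (Suc (Suc (Suc n))))))) p)" for b
      unfolding inst_def subst_subst by (rule subst_cong) (auto simp: \<rho>_def split: nat.splits)
    with that show ?thesis by (metis EqE)
  qed
  let ?c = "Var 0"
  have "T \<turnstile> Ex (?E ?c)"
    using HA[rule_format, OF HA_pairing[of "Var 0" "Var (Suc 0)"]] by simp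
  then show ?thesis
  proof (rule ExE)
    let ?G = "?E ?c # map shift []"
    have "T \<turnstile> subst (\<rho> (Unpair1 ?c) (Unpair2 ?c)) p"
    proof -
      have "subst (\<rho> (Unpair1 ?c) (Unpair2 ?c)) p = subst ?\<tau>
          (subst (case_nat (Unpair1 (Var 0)) (case_nat (Unpair2 (Var 0)) (\<lambda>n. Var (Suc n)))) p)"
        unfolding subst_subst by (rule subst_cong) (auto simp: \<rho>_def split: nat.splits)
      then show ?thesis using theorem_subst[OF assms(2)] by (simp only:)
    qed
    then have "derives T ?G (subst (\<rho> (Unpair1 ?c) (Unpair2 ?c)) p)"
      by (rule theorem_weaken)
    moreover have "derives T ?G (Eq (Unpair1 ?c) (Var (Suc 0)))"
      "derives T ?G (Eq (Unpair2 ?c) (Var (Suc (Suc 0))))"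
      using Assm_Cons[of T "?E ?c" "map shift []"] unfolding And_iff by blast+
    ultimately have "derives T ?G (subst (\<rho> (Var (Suc 0)) (Var (Suc (Suc 0)))) p)"
      by (rule_tac replace1[OF replace2])
    moreover have "\<rho> (Var (Suc 0)) (Var (Suc (Suc 0))) = (\<lambda>n. Var (Suc n))"
      by (auto simp: \<rho>_def fun_eq_iff split: nat.splits)
    ultimately show "derives T ?G (shift p)" by (simp only: shift_def)
  qed
qed

text \<open>Each step merges two parameters into one, which lowers the bound on the free variables
  and, as a substitution of terms, stays within \<open>Pi_fm k\<close>. With one parameter left, the
  schema applies directly.\<close>

lemma DNE_at_bounded:
  assumes HA: "\<forall>p. HA \<turnstile> p \<longrightarrow> T \<turnstile> p" and DNE: "T \<tturnstile> DNE_Or (Pi_fm k) (Pi_fm k)"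
  shows "p \<in> Pi_fm k \<Longrightarrow> q \<in> Pi_fm k \<Longrightarrow> FV p \<union> FV q \<subseteq> {..<Suc n} \<Longrightarrow>
    T \<turnstile> Imp (Neg (Neg (Or p q))) (Or p q)"
proof (induction n arbitrary: p q)
  case 0
  let ?F = "Imp (Neg (Neg (Or p q))) (Or p q)"
  have "All ?F \<in> DNE_Or (Pi_fm k) (Pi_fm k)"
    unfolding DNE_Or_def mem_Collect_eq
    by (rule exI[of _ p], rule exI[of _ q]) (use 0 in auto)
  then have "T \<turnstile> All ?F" using DNE unfolding proves_schema_def by (rule bspec[rotated])
  then show ?case by (simp only: All_iff list.map)
next
  case (Suc n)
  let ?\<sigma> = "case_nat (Unpair1 (Var 0)) (case_nat (Unpair2 (Var 0)) (\<lambda>n. Var (Suc n)))"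
  have fv: "fv_tm (?\<sigma> i) \<subseteq> {..<Suc n}" if "i < Suc (Suc n)" for i
    using that by (auto split: nat.splits)
  have "FV (subst ?\<sigma> p) \<union> FV (subst ?\<sigma> q) \<subseteq> {..<Suc n}"
    unfolding FV_subst using Suc.prems(3) fv by blast
  then have "T \<turnstile> Imp (Neg (Neg (Or (subst ?\<sigma> p) (subst ?\<sigma> q)))) (Or (subst ?\<sigma> p) (subst ?\<sigma> q))"
    using Suc.prems(1,2) by (intro Suc.IH subst_prenex)
  then show ?case
    by (rule_tac merge_parameters[OF HA]) (simp only: subst.simps)
qed

lemma DNE_at_iff:
  assumes HA: "\<forall>p. HA \<turnstile> p \<longrightarrow> T \<turnstile> p"
  shows "T \<tturnstile> DNE_Or (Pi_fm k) (Pi_fm k) \<longleftrightarrow> DNE_at T k"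
proof
  assume DNE: "T \<tturnstile> DNE_Or (Pi_fm k) (Pi_fm k)"
  show "DNE_at T k"
    unfolding DNE_at_def
  proof (intro ballI)
    fix p q assume pq: "p \<in> Pi_fm k" "q \<in> Pi_fm k"
    obtain N where "FV (Or p q) \<subseteq> {..<N}" by (rule FV_bounded)
    then have "FV p \<union> FV q \<subseteq> {..<Suc N}" by auto
    with pq show "T \<turnstile> Imp (Neg (Neg (Or p q))) (Or p q)"
      by (rule DNE_at_bounded[OF HA DNE])
  qed
next
  assume *: "DNE_at T k"
  show "T \<tturnstile> DNE_Or (Pi_fm k) (Pi_fm k)"
    unfolding proves_schema_def DNE_Or_def
  proof (clarify, unfold All_iff list.map)
    fix p q assume "p \<in> Pi_fm k" "q \<in> Pi_fm k"
    with * show "T \<turnstile> Imp (Neg (Neg (Or p q))) (Or p q)" unfolding DNE_at_def by blast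
  qed
qed

section \<open>Prenex equivalents\<close>

text \<open>Equality of the free variables is built in because \<open>PNFT\<close> demands it; every
  transformation below has to preserve them.\<close>

definition fm_equiv :: "fm set \<Rightarrow> fm \<Rightarrow> fm \<Rightarrow> bool" where
  "fm_equiv T p q \<longleftrightarrow> FV p = FV q \<and> T \<turnstile> Iff p q"

definition equiv_in :: "fm set \<Rightarrow> fm set \<Rightarrow> fm \<Rightarrow> bool" where
  "equiv_in T C p \<longleftrightarrow> (\<exists>q\<in>C. fm_equiv T p q)"

lemma fm_equivI:
  "FV p = FV q \<Longrightarrow> derives T [p] q \<Longrightarrow> derives T [q] p \<Longrightarrow> fm_equiv T p q"
  by (simp add: fm_equiv_def)

lemma fm_equivD:
  assumes "fm_equiv T p q"
  shows "FV p = FV q" "T \<turnstile> Imp p q" "T \<turnstile> Imp q p"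
  using assms by (simp_all add: fm_equiv_def)

lemma fm_equiv_trans:
  assumes "fm_equiv T p q" "fm_equiv T q r"
  shows "fm_equiv T p r"
proof (rule fm_equivI)
  note p = fm_equivD[OF assms(1)] and q = fm_equivD[OF assms(2)]
  show "FV p = FV r" using p q by simp
  show "derives T [p] r" by (rule use_theorem[OF q(2)], rule use_theorem[OF p(2)]) simp
  show "derives T [r] p" by (rule use_theorem[OF p(3)], rule use_theorem[OF q(3)]) simp
qed

lemma fm_equiv_refl: "fm_equiv T p p"
  by (simp add: fm_equiv_def)

lemma fm_equiv_And:
  assumes "fm_equiv T p p'" "fm_equiv T q q'"
  shows "fm_equiv T (And p q) (And p' q')"
proof (rule fm_equivI)
  note p = fm_equivD[OF assms(1)] and q = fm_equivD[OF assms(2)]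
  show "FV (And p q) = FV (And p' q')" using p q by simp
  show "derives T [And p q] (And p' q')" unfolding And_iff And_left
    by (rule conjI, rule use_theorem[OF p(2)], simp, rule use_theorem[OF q(2)], rule Assm, simp)
  show "derives T [And p' q'] (And p q)" unfolding And_iff And_left
    by (rule conjI, rule use_theorem[OF p(3)], simp, rule use_theorem[OF q(3)], rule Assm, simp)
qed

lemma fm_equiv_Or:
  assumes "fm_equiv T p p'" "fm_equiv T q q'"
  shows "fm_equiv T (Or p q) (Or p' q')"
proof (rule fm_equivI)
  note p = fm_equivD[OF assms(1)] and q = fm_equivD[OF assms(2)]
  show "FV (Or p q) = FV (Or p' q')" using p q by simp
  show "derives T [Or p q] (Or p' q')" unfolding Or_left
    by (rule conjI, rule OrI1, rule use_theorem[OF p(2)], simp,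
        rule OrI2, rule use_theorem[OF q(2)], simp)
  show "derives T [Or p' q'] (Or p q)" unfolding Or_left
    by (rule conjI, rule OrI1, rule use_theorem[OF p(3)], simp,
        rule OrI2, rule use_theorem[OF q(3)], simp)
qed

lemma fm_equiv_Imp:
  assumes "fm_equiv T p p'" "fm_equiv T q q'"
  shows "fm_equiv T (Imp p q) (Imp p' q')"
proof (rule fm_equivI)
  note p = fm_equivD[OF assms(1)] and q = fm_equivD[OF assms(2)]
  show "FV (Imp p q) = FV (Imp p' q')" using p q by simp
  show "derives T [Imp p q] (Imp p' q')"
    by (rule ImpI, rule use_theorem[OF q(2)], rule mp_assm[of p], simp, rule use_theorem[OF p(3)], simp)
  show "derives T [Imp p' q'] (Imp p q)"
    by (rule ImpI, rule use_theorem[OF q(3)], rule mp_assm[of p'], simp, rule use_theorem[OF p(2)], simp)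
qed

lemma fm_equiv_All:
  assumes "fm_equiv T p q"
  shows "fm_equiv T (All p) (All q)"
proof (rule fm_equivI)
  note p = fm_equivD[OF assms]
  show "FV (All p) = FV (All q)" using p by simp
  have "derives T [shift (All p)] q" "derives T [shift (All q)] p"
    by (rule use_theorem[OF p(2)], rule AllE_assm, simp)
      (rule use_theorem[OF p(3)], rule AllE_assm, simp)
  then show "derives T [All p] (All q)" "derives T [All q] (All p)" by simp_all
qed

lemma fm_equiv_Ex:
  assumes "fm_equiv T p q"
  shows "fm_equiv T (Ex p) (Ex q)"
proof (rule fm_equivI)
  note p = fm_equivD[OF assms]
  show "FV (Ex p) = FV (Ex q)" using p by simp
  have "derives T [p] (shift (Ex q))" "derives T [q] (shift (Ex p))"
    by (rule ExI_shift, rule use_theorem[OF p(2)], simp)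
      (rule ExI_shift, rule use_theorem[OF p(3)], simp)
  then show "derives T [Ex p] (Ex q)" "derives T [Ex q] (Ex p)" by simp_all
qed

lemma equiv_in_self: "p \<in> C \<Longrightarrow> equiv_in T C p"
  using fm_equiv_refl unfolding equiv_in_def by blast

lemma equiv_in_trans: "fm_equiv T p q \<Longrightarrow> equiv_in T C q \<Longrightarrow> equiv_in T C p"
  using fm_equiv_trans unfolding equiv_in_def by blast

lemma equiv_in_mono: "equiv_in T C p \<Longrightarrow> C \<subseteq> C' \<Longrightarrow> equiv_in T C' p"
  unfolding equiv_in_def by blast

lemma equiv_in_All: "equiv_in T (Pi_fm (Suc m)) p \<Longrightarrow> equiv_in T (Pi_fm (Suc m)) (All p)"
  using fm_equiv_All All_in_Pi unfolding equiv_in_def by blast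

lemma equiv_in_Ex: "equiv_in T (Sigma_fm (Suc m)) p \<Longrightarrow> equiv_in T (Sigma_fm (Suc m)) (Ex p)"
  using fm_equiv_Ex Ex_in_Sigma unfolding equiv_in_def by blast

section \<open>Moving quantifiers out of conjunctions and disjunctions\<close>

lemma And_commute: "fm_equiv T (And p q) (And q p)"
  by (rule fm_equivI) (auto simp: Assm)

lemma Or_commute: "fm_equiv T (Or p q) (Or q p)"
  by (rule fm_equivI, fastforce, unfold Or_left)
    (rule conjI, rule OrI2, simp, rule OrI1, simp)+

lemma Ex_And_pull: "fm_equiv T (And (Ex p) q) (Ex (And p (shift q)))"
proof (rule fm_equivI)
  show "FV (And (Ex p) q) = FV (Ex (And p (shift q)))" by auto
  have "derives T [p, shift q] (shift (Ex (And p (shift q))))"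
    by (rule ExI_shift) (simp add: Assm)
  then show "derives T [And (Ex p) q] (Ex (And p (shift q)))" by simp
  have "derives T [p, shift q] (shift (Ex p))" by (rule ExI_shift) simp
  then show "derives T [Ex (And p (shift q))] (And (Ex p) q)" by (simp add: Assm)
qed

lemma Ex_Or_pull: "fm_equiv T (Or (Ex p) q) (Ex (Or p (shift q)))"
proof (rule fm_equivI)
  show "FV (Or (Ex p) q) = FV (Ex (Or p (shift q)))" by auto
  have "derives T [p] (shift (Ex (Or p (shift q))))"
    by (rule ExI_shift, rule OrI1) simp
  \<comment> \<open>The witness is arbitrary, since \<open>q\<close> does not depend on it;
    \<open>Zero\<close> shows that the domain is inhabited.\<close>
  moreover have "derives T [q] (Ex (Or p (shift q)))"
    by (rule ExI[of _ _ Zero], unfold inst_simps inst_shift, rule OrI2) simp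
  ultimately show "derives T [Or (Ex p) q] (Ex (Or p (shift q)))" by simp
  have "derives T [p] (Or (shift (Ex p)) (shift q))"
    by (rule OrI1, rule ExI_shift) simp
  moreover have "derives T [shift q] (Or (shift (Ex p)) (shift q))"
    by (rule OrI2) simp
  ultimately show "derives T [Ex (Or p (shift q))] (Or (Ex p) q)" by simp
qed

lemma All_And_pull: "fm_equiv T (And (All p) q) (All (And p (shift q)))"
proof (rule fm_equivI)
  show "FV (And (All p) q) = FV (All (And p (shift q)))" by auto
  have "derives T [shift (All p), shift q] p" by (rule AllE_assm) simp
  then show "derives T [And (All p) q] (All (And p (shift q)))" by (simp add: Assm)
  have *: "derives T [shift (All (And p (shift q)))] (And p (shift q))"
    by (rule AllE_assm) simp
  have "derives T [All (And p (shift q))] (inst Zero (And p (shift q)))"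
    by (rule AllE[OF Assm]) simp
  then show "derives T [All (And p (shift q))] (And (All p) q)" using * by simp
qed

text \<open>The one quantifier shift here that is not intuitionistic. Refuting both disjuncts of the
  target contradicts the hypothesis, and as both are in \<open>Pi_fm (Suc m)\<close> the schema
  applies.\<close>

lemma All_Or_pull:
  assumes DNE: "DNE_at T (Suc m)" and p: "p \<in> Pi_fm (Suc m)" and q: "q \<in> Pi_fm (Suc m)"
  shows "fm_equiv T (Or (All p) q) (All (Or p (shift q)))"
proof (rule fm_equivI)
  show "FV (Or (All p) q) = FV (All (Or p (shift q)))" by auto
  have "derives T [shift (All p)] (Or p (shift q))"
    by (rule OrI1, rule AllE_assm) simp
  moreover have "derives T [shift q] (Or p (shift q))" by (rule OrI2) simp
  ultimately show "derives T [Or (All p) q] (All (Or p (shift q)))" by simp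
  show "derives T [All (Or p (shift q))] (Or (All p) q)"
  proof (rule DNE_at_Or[OF DNE All_in_Pi[OF p] q])
    let ?G = "[Neg (All p), Neg q, All (Or p (shift q))]"
    have "derives T (map shift ?G) (Or p (shift q))" by (rule AllE_assm) simp
    then have "derives T (map shift ?G) p"
    proof (rule OrE)
      show "derives T (shift q # map shift ?G) p"
        by (rule BotE, rule mp_assm[of "shift q"]) simp_all
    qed simp
    then have "derives T ?G (All p)" by (rule AllI)
    then have "derives T ?G Bot" by (rule mp_assm[rotated]) simp
    then show "derives T [Neg (Or (All p) q), All (Or p (shift q))] Bot" by simp
  qed
qed

text \<open>One argument for \<open>And\<close> and \<open>Or\<close>: quantifiers are pulled from
  the left operand and, after commuting, from the right one. Universal pulling is assumed only up to
  level \<open>k\<close>, as \<open>Or\<close> permits it only where DNE is available.\<close>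

lemma prenex_binary:
  fixes c :: "fm \<Rightarrow> fm \<Rightarrow> fm"
  assumes qf: "\<And>p q. qf p \<Longrightarrow> qf q \<Longrightarrow> qf (c p q)"
    and comm: "\<And>p q. fm_equiv T (c p q) (c q p)"
    and Ex: "\<And>p q. fm_equiv T (c (Ex p) q) (Ex (c p (shift q)))"
    and All: "\<And>j p q. j < k \<Longrightarrow> p \<in> Pi_fm (Suc j) \<Longrightarrow> q \<in> Pi_fm (Suc j) \<Longrightarrow>
      fm_equiv T (c (All p) q) (All (c p (shift q)))"
  shows "m \<le> k \<Longrightarrow> p \<in> Sigma_fm m \<Longrightarrow> q \<in> Sigma_fm m \<Longrightarrow> equiv_in T (Sigma_fm m) (c p q)"
    and "m \<le> k \<Longrightarrow> p \<in> Pi_fm m \<Longrightarrow> q \<in> Pi_fm m \<Longrightarrow> equiv_in T (Pi_fm m) (c p q)"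
proof (induction m arbitrary: p q)
  case 0
  { case 1 then show ?case by (intro equiv_in_self) (simp add: qf) }
  { case 2 then show ?case by (intro equiv_in_self) (simp add: qf) }
next
  case (Suc m)
  { case 1
    from 1(2,3) show ?case
    proof (induction arbitrary: q rule: Sigma_Suc_induct)
      case (Ex p)
      from Ex.IH[OF shift_prenex(1)[OF Ex.prems]]
      show ?case by (rule equiv_in_trans[OF assms(3) equiv_in_Ex])
    next
      case (Pi p)
      from Pi(2,1) show ?case
      proof (induction arbitrary: p rule: Sigma_Suc_induct)
        case (Ex q)
        from Ex.IH[OF shift_prenex(2)[OF Ex.prems]]
        have "equiv_in T (Sigma_fm (Suc m)) (c q (shift p))"
          by (rule equiv_in_trans[OF comm])
        then have "equiv_in T (Sigma_fm (Suc m)) (c (Ex q) p)"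
          by (rule equiv_in_trans[OF assms(3) equiv_in_Ex])
        then show ?case by (rule equiv_in_trans[OF comm])
      next
        case (Pi q)
        have "equiv_in T (Pi_fm m) (c p q)" using Suc.IH(2) Pi \<open>Suc m \<le> k\<close> by simp
        then show ?case using Pi_subset_Sigma_Suc by (rule equiv_in_mono)
      qed
    qed }
  { case 2
    then have m: "m < k" by simp
    from 2(2,3) show ?case
    proof (induction arbitrary: q rule: Pi_Suc_induct)
      case (All p)
      from All.IH[OF shift_prenex(2)[OF All.prems]]
      show ?case by (rule equiv_in_trans[OF assms(4)[OF m All.hyps All.prems] equiv_in_All])
    next
      case (Sigma p)
      from Sigma(2,1) show ?case
      proof (induction arbitrary: p rule: Pi_Suc_induct)
        case (All q)
        from All.IH[OF shift_prenex(1)[OF All.prems]]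
        have *: "equiv_in T (Pi_fm (Suc m)) (c q (shift p))"
          by (rule equiv_in_trans[OF comm])
        have "p \<in> Pi_fm (Suc m)" using All.prems Sigma_subset_Pi_Suc by blast
        with * have "equiv_in T (Pi_fm (Suc m)) (c (All q) p)"
          by (intro equiv_in_trans[OF assms(4)[OF m All.hyps] equiv_in_All])
        then show ?case by (rule equiv_in_trans[OF comm])
      next
        case (Sigma q)
        have "equiv_in T (Sigma_fm m) (c p q)" using Suc.IH(1) Sigma m by simp
        then show ?case using Sigma_subset_Pi_Suc by (rule equiv_in_mono)
      qed
    qed }
qed

lemma equiv_in_And:
  "equiv_in T (Sigma_fm m) p \<Longrightarrow> equiv_in T (Sigma_fm m) q \<Longrightarrow> equiv_in T (Sigma_fm m) (And p q)"
  "equiv_in T (Pi_fm m) p \<Longrightarrow> equiv_in T (Pi_fm m) q \<Longrightarrow> equiv_in T (Pi_fm m) (And p q)"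
proof -
  note And = prenex_binary[of And T m, OF _ And_commute Ex_And_pull All_And_pull order_refl]
  { assume "equiv_in T (Sigma_fm m) p" "equiv_in T (Sigma_fm m) q"
    then obtain p' q' where pq: "p' \<in> Sigma_fm m" "fm_equiv T p p'" "q' \<in> Sigma_fm m" "fm_equiv T q q'"
      unfolding equiv_in_def by blast
    have "equiv_in T (Sigma_fm m) (And p' q')" by (rule And(1)) (use pq in simp_all)
    then show "equiv_in T (Sigma_fm m) (And p q)"
      by (rule equiv_in_trans[OF fm_equiv_And[OF pq(2,4)]]) }
  { assume "equiv_in T (Pi_fm m) p" "equiv_in T (Pi_fm m) q"
    then obtain p' q' where pq: "p' \<in> Pi_fm m" "fm_equiv T p p'" "q' \<in> Pi_fm m" "fm_equiv T q q'"
      unfolding equiv_in_def by blast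
    have "equiv_in T (Pi_fm m) (And p' q')" by (rule And(2)) (use pq in simp_all)
    then show "equiv_in T (Pi_fm m) (And p q)"
      by (rule equiv_in_trans[OF fm_equiv_And[OF pq(2,4)]]) }
qed

lemma equiv_in_Or:
  assumes "DNE_at T m"
  shows "equiv_in T (Sigma_fm m) p \<Longrightarrow> equiv_in T (Sigma_fm m) q \<Longrightarrow> equiv_in T (Sigma_fm m) (Or p q)"
    and "equiv_in T (Pi_fm m) p \<Longrightarrow> equiv_in T (Pi_fm m) q \<Longrightarrow> equiv_in T (Pi_fm m) (Or p q)"
proof -
  have DNE: "DNE_at T (Suc j)" if "j < m" for j using DNE_at_mono[OF assms] that by simp
  note Or = prenex_binary[of Or T m, OF _ Or_commute Ex_Or_pull All_Or_pull[OF DNE] order_refl]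
  { assume "equiv_in T (Sigma_fm m) p" "equiv_in T (Sigma_fm m) q"
    then obtain p' q' where pq: "p' \<in> Sigma_fm m" "fm_equiv T p p'" "q' \<in> Sigma_fm m" "fm_equiv T q q'"
      unfolding equiv_in_def by blast
    have "equiv_in T (Sigma_fm m) (Or p' q')" by (rule Or(1)) (use pq in simp_all)
    then show "equiv_in T (Sigma_fm m) (Or p q)"
      by (rule equiv_in_trans[OF fm_equiv_Or[OF pq(2,4)]]) }
  { assume "equiv_in T (Pi_fm m) p" "equiv_in T (Pi_fm m) q"
    then obtain p' q' where pq: "p' \<in> Pi_fm m" "fm_equiv T p p'" "q' \<in> Pi_fm m" "fm_equiv T q q'"
      unfolding equiv_in_def by blast
    have "equiv_in T (Pi_fm m) (Or p' q')" by (rule Or(2)) (use pq in simp_all)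
    then show "equiv_in T (Pi_fm m) (Or p q)"
      by (rule equiv_in_trans[OF fm_equiv_Or[OF pq(2,4)]]) }
qed

section \<open>Stability and classical equivalences of connectives\<close>

lemma Or_stable:
  assumes "DNE_at T k" "equiv_in T (Pi_fm k) p" "equiv_in T (Pi_fm k) q"
    and "derives T (Neg (Or p q) # G) Bot"
  shows "derives T G (Or p q)"
proof -
  from assms(2,3) obtain p' q' where p': "p' \<in> Pi_fm k" "fm_equiv T p p'"
    and q': "q' \<in> Pi_fm k" "fm_equiv T q q'" unfolding equiv_in_def by blast
  note eq = fm_equivD[OF fm_equiv_Or[OF p'(2) q'(2)]]
  have "derives T (Neg (Or p' q') # G) (Neg (Or p q))"
    by (rule ImpI, rule mp_assm[of "Or p' q'"], simp, rule use_theorem[OF eq(2)], rule Assm, simp)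
  moreover have "derives T (Neg (Or p' q') # G) (Neg (Neg (Or p q)))"
    by (rule weaken[OF ImpI[OF assms(4)]]) auto
  ultimately have "derives T (Neg (Or p' q') # G) Bot" by (rule ImpE[rotated])
  then have "derives T G (Or p' q')" by (rule DNE_at_Or[OF assms(1) p'(1) q'(1)])
  then show ?thesis by (rule use_theorem[OF eq(3)])
qed

lemma stable:
  assumes "DNE_at T k" "equiv_in T (Pi_fm k) p" "derives T (Neg p # G) Bot"
  shows "derives T G p"
proof -
  \<comment> \<open>Taking \<open>Bot\<close> as second disjunct turns DNE for disjunctions into
    stability of a single formula.\<close>
  have "equiv_in T (Pi_fm k) Bot" by (intro equiv_in_self qf_in_prenex) simp
  moreover have "derives T (Neg (Or p Bot) # G) Bot"
    unfolding Neg_Or_left by (rule weaken[OF assms(3)]) auto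
  ultimately have "derives T G (Or p Bot)" by (rule Or_stable[OF assms(1,2)])
  then show ?thesis by (rule OrE) simp_all
qed

text \<open>Intuitionistically the left side refutes the negation of the disjunction;
  \<open>Or_stable\<close> does the rest, as both disjuncts have equivalents in
  \<open>Pi_fm k\<close>.\<close>

lemma Neg_And_equiv:
  assumes "DNE_at T k" "equiv_in T (Pi_fm k) (Neg p)" "equiv_in T (Pi_fm k) (Neg q)"
  shows "fm_equiv T (Neg (And p q)) (Or (Neg p) (Neg q))"
proof (rule fm_equivI)
  have "derives T [Neg (Neg p), Neg (Neg q), Neg (And p q)] Bot"
    by (rule mp_assm[of "Neg p"], simp, rule ImpI, rule mp_assm[of "Neg q"], simp, rule ImpI,
        rule mp_assm[of "And p q"]) (simp_all add: Assm)
  then show "derives T [Neg (And p q)] (Or (Neg p) (Neg q))"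
    by (intro Or_stable[OF assms]) (simp only: Neg_Or_left)
  have "derives T [p, q, Neg p] Bot" by (rule mp_assm[of p]) simp_all
  moreover have "derives T [p, q, Neg q] Bot" by (rule mp_assm[of q]) (simp_all add: Assm)
  ultimately show "derives T [Or (Neg p) (Neg q)] (Neg (And p q))"
    unfolding Or_left by simp
qed auto

lemma Neg_Or_equiv: "fm_equiv T (Neg (Or p q)) (And (Neg p) (Neg q))"
proof (rule fm_equivI)
  have "derives T [p, Neg p, Neg q] Bot" by (rule mp_assm[of p]) simp_all
  moreover have "derives T [q, Neg p, Neg q] Bot" by (rule mp_assm[of q]) simp_all
  ultimately show "derives T [Neg (Or p q)] (And (Neg p) (Neg q))"
    "derives T [And (Neg p) (Neg q)] (Neg (Or p q))"
    unfolding Neg_Or_left And_left by simp_all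
qed auto

lemma Imp_equiv:
  assumes "DNE_at T k" "equiv_in T (Pi_fm k) (Neg p)" "equiv_in T (Pi_fm k) q"
  shows "fm_equiv T (Imp p q) (Or (Neg p) q)"
proof (rule fm_equivI)
  have "derives T [Neg (Neg p), Neg q, Imp p q] Bot"
    by (rule mp_assm[of "Neg p"], simp, rule ImpI, rule mp_assm[of q], simp,
        rule mp_assm[of p]) (simp_all add: Assm)
  then show "derives T [Imp p q] (Or (Neg p) q)"
    by (intro Or_stable[OF assms]) (simp only: Neg_Or_left)
  have "derives T [p, Neg p] q" by (rule BotE, rule mp_assm[of p]) simp_all
  then show "derives T [Or (Neg p) q] (Imp p q)"
    unfolding Or_left by (simp add: Assm)
qed auto

lemma Neg_Imp_equiv:
  assumes "DNE_at T k" "equiv_in T (Pi_fm k) p"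
  shows "fm_equiv T (Neg (Imp p q)) (And p (Neg q))"
proof (rule fm_equivI)
  have "derives T [Neg p, Neg (Imp p q)] Bot"
    by (rule mp_assm[of "Imp p q"], simp, rule ImpI, rule BotE, rule mp_assm[of p]) simp_all
  then have "derives T [Neg (Imp p q)] p" by (rule stable[OF assms])
  moreover have "derives T [Neg (Imp p q)] (Neg q)"
    by (rule ImpI, rule mp_assm[of "Imp p q"], simp, rule ImpI, rule Assm) simp
  ultimately show "derives T [Neg (Imp p q)] (And p (Neg q))" by (rule AndI)
  have "derives T [Imp p q, p, Neg q] Bot"
    by (rule mp_assm[of q], simp, rule mp_assm[of p]) (simp_all add: Assm)
  then show "derives T [And p (Neg q)] (Neg (Imp p q))"
    unfolding And_left by (rule ImpI)
qed auto

lemma Neg_Ex_equiv: "fm_equiv T (Neg (Ex p)) (All (Neg p))"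
proof (rule fm_equivI)
  have "derives T [p, Neg (shift (Ex p))] Bot"
    by (rule mp_assm[of "shift (Ex p)"], simp, rule ExI_shift) simp
  then show "derives T [Neg (Ex p)] (All (Neg p))" by simp
  have "derives T [p, shift (All (Neg p))] (Neg p)" by (rule AllE_assm) simp
  then have "derives T [p, shift (All (Neg p))] Bot" by (rule ImpE) simp
  then show "derives T [All (Neg p)] (Neg (Ex p))" by simp
qed auto

lemma Neg_dual_equiv:
  assumes "decides T m" "p \<in> Sigma_fm m \<union> Pi_fm m"
  shows "fm_equiv T (Neg p) (dual_fm p)"
proof (rule fm_equivI)
  show "derives T [Neg p] (dual_fm p)"
    by (rule decides_cases[OF assms], rule BotE, rule mp_assm[of p]) simp_all
  have "derives T [p, dual_fm p] Bot"
    by (rule weaken[OF dual_fm_contradiction[of T p "[]"]]) auto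
  then show "derives T [dual_fm p] (Neg p)" by (rule ImpI)
qed simp

lemma Imp_dual_equiv:
  assumes "decides T m" "p \<in> Sigma_fm m \<union> Pi_fm m"
  shows "fm_equiv T (Imp p q) (Or (dual_fm p) q)"
proof (rule fm_equivI)
  show "derives T [Imp p q] (Or (dual_fm p) q)"
    by (rule decides_cases[OF assms], rule OrI2, rule mp_assm[of p], simp, simp, rule OrI1, simp)
  have "derives T [p, dual_fm p] q"
    by (rule BotE, rule weaken[OF dual_fm_contradiction[of T p "[]"]]) auto
  then show "derives T [Or (dual_fm p) q] (Imp p q)"
    unfolding Or_left by (simp add: Assm)
qed simp


section \<open>Alternation paths\<close>

text \<open>Only paths of the full length \<open>k\<close> are constrained in their first sign.
  Stating this with \<open>flip x\<close> lets the empty path pass for \<open>k = 0\<close>, and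
  admitting shorter paths makes the condition pass to subformulas.\<close>

definition fits :: "sign \<Rightarrow> nat \<Rightarrow> path \<Rightarrow> bool" where
  "fits x k s \<longleftrightarrow> length s < k \<or> length s = k \<and> init s \<noteq> Some (flip x)"

text \<open>\<open>below Minus k\<close> is the cumulative version of \<open>U\<^sub>k\<close>, and \<open>below Plus k\<close> its dual.\<close>

definition below :: "sign \<Rightarrow> nat \<Rightarrow> fm \<Rightarrow> bool" where
  "below x k p \<longleftrightarrow> (\<forall>s\<in>Alt p. fits x k s)"

lemma flip_eq_iff [simp]: "flip x = flip y \<longleftrightarrow> x = y"
  by (cases x; cases y) auto

lemma flip_flip [simp]: "flip (flip x) = x"
  by (cases x) auto

lemma fits_Nil [simp]: "fits x k []"
  by (auto simp: fits_def init_def)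

lemma fits_dual [simp]: "fits x k (dual s) \<longleftrightarrow> fits (flip x) k s"
  by (cases s) (auto simp: fits_def dual_def init_def)

lemma below_And: "below x k (And p q) \<longleftrightarrow> below x k p \<and> below x k q"
  by (auto simp: below_def)

lemma below_Or: "below x k (Or p q) \<longleftrightarrow> below x k p \<and> below x k q"
  by (auto simp: below_def)

text \<open>The special clause of \<open>Alt\<close> for negation is harmless here:
  \<open>Bot\<close> has only the empty path, which fits every level.\<close>

lemma below_Imp: "below x k (Imp p q) \<longleftrightarrow> below (flip x) k p \<and> below x k q"
  by (auto simp: below_def ball_Un)

lemma Alt_All_init: "s \<in> Alt (All p) \<Longrightarrow> init s = Some Minus"
  by (auto simp: init_def)

lemma Alt_Ex_init: "s \<in> Alt (Ex p) \<Longrightarrow> init s = Some Plus"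
  by (auto simp: init_def)

lemma below_AllD: "below Minus k (All p) \<Longrightarrow> below Minus k p"
  unfolding below_def
proof
  fix s assume *: "\<forall>s\<in>Alt (All p). fits Minus k s" "s \<in> Alt p"
  show "fits Minus k s"
  proof (cases "init s = Some Minus")
    case False
    with * have "fits Minus k (Minus # s)" by simp
    then show ?thesis by (auto simp: fits_def)
  qed (use * in simp)
qed

lemma below_ExD: "below Plus k (Ex p) \<Longrightarrow> below Plus k p"
  unfolding below_def
proof
  fix s assume *: "\<forall>s\<in>Alt (Ex p). fits Plus k s" "s \<in> Alt p"
  show "fits Plus k s"
  proof (cases "init s = Some Plus")
    case False
    with * have "fits Plus k (Plus # s)" by simp
    then show ?thesis by (auto simp: fits_def)
  qed (use * in simp)
qed

text \<open>All paths of a universal formula start with \<open>Minus\<close>, so none of them may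
  have the full length \<open>Suc k\<close>. This is what lets a quantifier of the wrong kind drop
  to the level below; \<open>below_Ex_lower\<close> is the dual.\<close>

lemma below_All_lower:
  assumes "below Plus (Suc k) (All p)"
  shows "below Minus k (All p)"
  unfolding below_def
proof
  fix s assume s: "s \<in> Alt (All p)"
  then have "fits Plus (Suc k) s" using assms unfolding below_def by blast
  then show "fits Minus k s" using Alt_All_init[OF s] by (auto simp: fits_def)
qed

lemma below_Ex_lower:
  assumes "below Minus (Suc k) (Ex p)"
  shows "below Plus k (Ex p)"
  unfolding below_def
proof
  fix s assume s: "s \<in> Alt (Ex p)"
  then have "fits Minus (Suc k) s" using assms unfolding below_def by blast
  then show "fits Plus k s" using Alt_Ex_init[OF s] by (auto simp: fits_def)
qed

lemma below_0_qf: "below x 0 p \<Longrightarrow> qf p"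
proof (induction p arbitrary: x)
  case (And p q)
  then show ?case by (auto simp: below_And)
next
  case (Or p q)
  then show ?case by (auto simp: below_Or)
next
  case (Imp p q)
  then show ?case by (auto simp: below_Imp)
next
  case (All p)
  obtain s where s: "s \<in> Alt (All p)" using Alt_nonempty[of "All p"] by blast
  then have "s = []" using All.prems unfolding below_def fits_def by blast
  then show ?case using Alt_All_init[OF s] by (simp add: init_def)
next
  case (Ex p)
  obtain s where s: "s \<in> Alt (Ex p)" using Alt_nonempty[of "Ex p"] by blast
  then have "s = []" using Ex.prems unfolding below_def fits_def by blast
  then show ?case using Alt_Ex_init[OF s] by (simp add: init_def)
qed auto

lemma U_class_below: "p \<in> U_class k \<Longrightarrow> below Minus k p"
proof -
  assume p: "p \<in> U_class k"
  have deg: "length s \<le> deg p" if "s \<in> Alt p" for s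
    unfolding deg_def using that finite_Alt by simp
  show ?thesis
    unfolding below_def
  proof
    fix s assume s: "s \<in> Alt p"
    show "fits Minus k s"
    proof (cases k)
      case 0
      then have "s = []" using p deg[OF s] by (simp add: F_class_def)
      then show ?thesis by simp
    next
      case (Suc j)
      then show ?thesis using p s deg[OF s] by (auto simp: F_class_def fits_def)
    qed
  qed
qed

text \<open>Formulas of the dual type are treated through their negations, since
  \<open>Sigma_fm (Suc m)\<close> equivalents would call for decidability at level
  \<open>Suc m\<close>, as in \<open>prenex_step_Sigma\<close>. An implication exchanges the two
  claims for its premise.\<close>

lemma prenex_step:
  assumes DNE: "DNE_at T (Suc m)" and dec: "decides T m"
    and U: "\<And>p. below Minus m p \<Longrightarrow> equiv_in T (Pi_fm m) p"
    and E: "\<And>p. below Plus m p \<Longrightarrow> equiv_in T (Sigma_fm m) p"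
  shows "below Minus (Suc m) p \<Longrightarrow> equiv_in T (Pi_fm (Suc m)) p"
    and "below Plus (Suc m) p \<Longrightarrow> equiv_in T (Pi_fm (Suc m)) (Neg p)"
proof (induction p)
  case (Eq s t)
  { case 1 show ?case by (intro equiv_in_self qf_in_prenex) simp }
  { case 2 show ?case by (intro equiv_in_self qf_in_prenex) simp }
next
  case Bot
  { case 1 show ?case by (intro equiv_in_self qf_in_prenex) simp }
  { case 2 show ?case by (intro equiv_in_self qf_in_prenex) simp }
next
  case (And p q)
  { case 1
    then have "equiv_in T (Pi_fm (Suc m)) p" "equiv_in T (Pi_fm (Suc m)) q"
      using And.IH by (simp_all add: below_And)
    then show ?case by (rule equiv_in_And) }
  { case 2
    then have "equiv_in T (Pi_fm (Suc m)) (Neg p)" "equiv_in T (Pi_fm (Suc m)) (Neg q)"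
      using And.IH by (simp_all add: below_And)
    then show ?case by - (rule equiv_in_trans[OF Neg_And_equiv[OF DNE] equiv_in_Or(2)[OF DNE]]) }
next
  case (Or p q)
  { case 1
    then have "equiv_in T (Pi_fm (Suc m)) p" "equiv_in T (Pi_fm (Suc m)) q"
      using Or.IH by (simp_all add: below_Or)
    then show ?case by (rule equiv_in_Or(2)[OF DNE]) }
  { case 2
    then have "equiv_in T (Pi_fm (Suc m)) (Neg p)" "equiv_in T (Pi_fm (Suc m)) (Neg q)"
      using Or.IH by (simp_all add: below_Or)
    then show ?case by (rule equiv_in_trans[OF Neg_Or_equiv equiv_in_And(2)]) }
next
  case (Imp p q)
  { case 1
    then have "equiv_in T (Pi_fm (Suc m)) (Neg p)" "equiv_in T (Pi_fm (Suc m)) q"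
      using Imp.IH by (simp_all add: below_Imp)
    then show ?case by - (rule equiv_in_trans[OF Imp_equiv[OF DNE] equiv_in_Or(2)[OF DNE]]) }
  { case 2
    then have "equiv_in T (Pi_fm (Suc m)) p" "equiv_in T (Pi_fm (Suc m)) (Neg q)"
      using Imp.IH by (simp_all add: below_Imp)
    then show ?case by - (rule equiv_in_trans[OF Neg_Imp_equiv[OF DNE] equiv_in_And(2)]) }
next
  case (All p)
  { case 1
    then show ?case by (intro equiv_in_All All.IH(1)) (rule below_AllD) }
  { case 2
    \<comment> \<open>The universal quantifier is of the wrong kind, so the formula drops to level
      \<open>m\<close>. There its equivalent is decidable, so the negation is the dual in
      \<open>Sigma_fm m\<close>, hence in \<open>Pi_fm (Suc m)\<close>.\<close>
    then have "equiv_in T (Pi_fm m) (All p)" by (intro U below_All_lower)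
    then obtain q where q: "q \<in> Pi_fm m" "fm_equiv T (All p) q" unfolding equiv_in_def by blast
    have "dual_fm q \<in> Pi_fm (Suc m)" using dual_fm_prenex(2)[OF q(1)] Sigma_subset_Pi_Suc by blast
    then have "equiv_in T (Pi_fm (Suc m)) (Neg q)"
      using q by (intro equiv_in_trans[OF Neg_dual_equiv[OF dec] equiv_in_self]) simp
    then show ?case by (rule equiv_in_trans[OF fm_equiv_Imp[OF q(2) fm_equiv_refl]]) }
next
  case (Ex p)
  { case 1
    then have "equiv_in T (Sigma_fm m) (Ex p)" by (intro E below_Ex_lower)
    then show ?case using Sigma_subset_Pi_Suc by (rule equiv_in_mono) }
  { case 2
    then show ?case by (intro equiv_in_trans[OF Neg_Ex_equiv equiv_in_All] Ex.IH(2)) (rule below_ExD) }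
qed

text \<open>The implication is the case that uses decidability: its premise has an equivalent in
  \<open>Pi_fm (Suc m)\<close>, whose dual replaces the premise as a disjunct.\<close>

lemma prenex_step_Sigma:
  assumes DNE: "DNE_at T (Suc m)" and dec: "decides T (Suc m)"
    and low: "\<And>p. below Minus m p \<Longrightarrow> equiv_in T (Pi_fm m) p"
    and U: "\<And>p. below Minus (Suc m) p \<Longrightarrow> equiv_in T (Pi_fm (Suc m)) p"
  shows "below Plus (Suc m) p \<Longrightarrow> equiv_in T (Sigma_fm (Suc m)) p"
proof (induction p)
  case (Eq s t)
  show ?case by (intro equiv_in_self qf_in_prenex) simp
next
  case Bot
  show ?case by (intro equiv_in_self qf_in_prenex) simp
next
  case (And p q)
  then show ?case by (intro equiv_in_And) (simp_all add: below_And)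
next
  case (Or p q)
  then show ?case by (intro equiv_in_Or[OF DNE]) (simp_all add: below_Or)
next
  case (Imp p q)
  then have q: "equiv_in T (Sigma_fm (Suc m)) q" by (simp add: below_Imp)
  have "equiv_in T (Pi_fm (Suc m)) p" using Imp.prems by (intro U) (simp add: below_Imp)
  then obtain p' where p': "p' \<in> Pi_fm (Suc m)" "fm_equiv T p p'" unfolding equiv_in_def by blast
  have "equiv_in T (Sigma_fm (Suc m)) (dual_fm p')"
    using dual_fm_prenex(2)[OF p'(1)] by (rule equiv_in_self)
  then have "equiv_in T (Sigma_fm (Suc m)) (Imp p' q)"
    using q p'(1) by - (rule equiv_in_trans[OF Imp_dual_equiv[OF dec] equiv_in_Or(1)[OF DNE]], simp)
  then show ?case by (rule equiv_in_trans[OF fm_equiv_Imp[OF p'(2) fm_equiv_refl]])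
next
  case (All p)
  then have "equiv_in T (Pi_fm m) (All p)" by (intro low below_All_lower)
  then show ?case using Pi_subset_Sigma_Suc by (rule equiv_in_mono)
next
  case (Ex p)
  then show ?case by (intro equiv_in_Ex Ex.IH) (rule below_ExD)
qed

text \<open>The second claim stops below \<open>k\<close>, because at a positive level
  \<open>m\<close> it uses decidability there, which comes from DNE at level
  \<open>m + 1\<close>.\<close>

lemma prenex_normal_form:
  assumes DNE: "DNE_at T k" and dec: "decides T 0"
  shows "m \<le> k \<Longrightarrow> (\<forall>p. below Minus m p \<longrightarrow> equiv_in T (Pi_fm m) p) \<and>
    (m < k \<longrightarrow> (\<forall>p. below Plus m p \<longrightarrow> equiv_in T (Sigma_fm m) p))"
proof (induction m)
  case 0
  have "equiv_in T (Pi_fm 0) p" "equiv_in T (Sigma_fm 0) p" if "below x 0 p" for x p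
    by (intro equiv_in_self qf_in_prenex below_0_qf[OF that])+
  then show ?case by blast
next
  case (Suc m)
  have DNE': "DNE_at T (Suc m)" using DNE Suc.prems by (rule DNE_at_mono)
  have low: "below Minus m p \<Longrightarrow> equiv_in T (Pi_fm m) p"
    "below Plus m p \<Longrightarrow> equiv_in T (Sigma_fm m) p" for p
    using Suc by simp_all
  have U: "equiv_in T (Pi_fm (Suc m)) p" if "below Minus (Suc m) p" for p
    by (rule prenex_step(1)[OF DNE' decides_DNE[OF DNE' dec] low that])
  have "equiv_in T (Sigma_fm (Suc m)) p" if "Suc m < k" "below Plus (Suc m) p" for p
  proof -
    have "DNE_at T (Suc (Suc m))" by (rule DNE_at_mono[OF DNE]) (use that(1) in simp)
    then have "decides T (Suc m)" using dec by (rule decides_DNE)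
    then show ?thesis by - (rule prenex_step_Sigma[OF DNE' _ low(1) U that(2)])
  qed
  with U show ?case by blast
qed


section \<open>From prenex normal forms to double negation elimination\<close>

primrec alternating :: "sign \<Rightarrow> nat \<Rightarrow> path" where
  "alternating x 0 = []"
| "alternating x (Suc m) = x # alternating (flip x) m"

lemma length_alternating [simp]: "length (alternating x m) = m"
  by (induction m arbitrary: x) auto

lemma init_alternating: "init (alternating x m) = (if m = 0 then None else Some x)"
  by (cases m) (auto simp: init_def)

lemma Alt_subst [simp]: "Alt (subst \<sigma> p) = Alt p"
proof (induction p arbitrary: \<sigma>)
  case (Imp p q)
  have "subst \<sigma> q = Bot \<longleftrightarrow> q = Bot" by (cases q) auto
  with Imp show ?case by simp
qed auto

lemma Alt_shift [simp]: "Alt (shift p) = Alt p"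
  by (simp add: shift_def)

lemma All_dummy: "fm_equiv T p (All (shift p))"
proof (rule fm_equivI)
  have "derives T [All (shift p)] (inst Zero (shift p))" by (rule AllE[OF Assm]) simp
  then show "derives T [All (shift p)] p" by simp
qed auto

lemma Ex_dummy: "fm_equiv T p (Ex (shift p))"
proof (rule fm_equivI)
  show "derives T [p] (Ex (shift p))" by (rule ExI[of _ _ Zero]) simp
qed auto

lemma Alt_Ex_singleton:
  "Alt p = {s} \<Longrightarrow> Alt (Ex p) = (if init s = Some Plus then {s} else {Plus # s})"
  by auto

lemma Alt_All_singleton:
  "Alt p = {s} \<Longrightarrow> Alt (All p) = (if init s = Some Minus then {s} else {Minus # s})"
  by auto

text \<open>Blocks may be empty, so a formula in \<open>Pi_fm m\<close> can have degree below
  \<open>m\<close>, whereas \<open>U_class m\<close> fixes the degree. A dummy quantifier is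
  prefixed at each level, which leaves the free variables unchanged.\<close>

lemma prenex_padding:
  "p \<in> Sigma_fm m \<Longrightarrow> equiv_in T {q \<in> Sigma_fm m. Alt q = {alternating Plus m}} p"
  "p \<in> Pi_fm m \<Longrightarrow> equiv_in T {q \<in> Pi_fm m. Alt q = {alternating Minus m}} p"
proof (induction m arbitrary: p)
  case 0
  { case 1 then show ?case by (intro equiv_in_self) (simp add: Alt_qf) }
  { case 2 then show ?case by (intro equiv_in_self) (simp add: Alt_qf) }
next
  case (Suc m)
  { case 1
    then show ?case
    proof (induction rule: Sigma_Suc_induct)
      case (Pi p)
      from Suc.IH(2)[OF this] obtain q where q: "q \<in> Pi_fm m" "Alt q = {alternating Minus m}"
        "fm_equiv T p q" unfolding equiv_in_def by blast
      have "Ex (shift q) \<in> Sigma_fm (Suc m)"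
        by (rule Ex_in_Sigma[OF subsetD[OF Pi_subset_Sigma_Suc shift_prenex(2)[OF q(1)]]])
      moreover have "Alt (Ex (shift q)) = {alternating Plus (Suc m)}"
        using Alt_Ex_singleton[of "shift q"] q(2) by (simp add: init_alternating del: Alt.simps)
      ultimately show ?case
        by (intro equiv_in_trans[OF fm_equiv_trans[OF q(3) Ex_dummy] equiv_in_self]) simp
    next
      case (Ex p)
      from Ex.IH obtain q where q: "q \<in> Sigma_fm (Suc m)" "Alt q = {alternating Plus (Suc m)}"
        "fm_equiv T p q" unfolding equiv_in_def by blast
      then show ?case
        by (intro equiv_in_trans[OF fm_equiv_Ex[OF q(3)]] equiv_in_self)
          (simp add: Ex_in_Sigma Alt_Ex_singleton init_def del: Alt.simps)
    qed }
  { case 2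
    then show ?case
    proof (induction rule: Pi_Suc_induct)
      case (Sigma p)
      from Suc.IH(1)[OF this] obtain q where q: "q \<in> Sigma_fm m" "Alt q = {alternating Plus m}"
        "fm_equiv T p q" unfolding equiv_in_def by blast
      have "All (shift q) \<in> Pi_fm (Suc m)"
        by (rule All_in_Pi[OF subsetD[OF Sigma_subset_Pi_Suc shift_prenex(1)[OF q(1)]]])
      moreover have "Alt (All (shift q)) = {alternating Minus (Suc m)}"
        using Alt_All_singleton[of "shift q"] q(2) by (simp add: init_alternating del: Alt.simps)
      ultimately show ?case
        by (intro equiv_in_trans[OF fm_equiv_trans[OF q(3) All_dummy] equiv_in_self]) simp
    next
      case (All p)
      from All.IH obtain q where q: "q \<in> Pi_fm (Suc m)" "Alt q = {alternating Minus (Suc m)}"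
        "fm_equiv T p q" unfolding equiv_in_def by blast
      then show ?case
        by (intro equiv_in_trans[OF fm_equiv_All[OF q(3)]] equiv_in_self)
          (simp add: All_in_Pi Alt_All_singleton init_def del: Alt.simps)
    qed }
qed

lemma alternating_U_class:
  assumes "Alt p = {alternating Minus k}"
  shows "p \<in> U_class k"
  using assms by (cases k) (auto simp: F_class_def deg_def init_def)

lemma dual_dual [simp]: "dual (dual s) = s"
  by (simp add: dual_def comp_def)

lemma DNE_qf:
  assumes "decides T 0"
  shows "DNE_at T 0"
  unfolding DNE_at_def
proof (intro ballI)
  fix p q assume "p \<in> Pi_fm 0" "q \<in> Pi_fm 0"
  then have qf: "qf (Or p q)" by simp
  have "derives T [Neg (Neg (Or p q))] (Or p q)"
  proof (rule decides_cases[OF assms, of "Or p q"])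
    show "derives T [dual_fm (Or p q), Neg (Neg (Or p q))] (Or p q)"
      unfolding dual_fm_qf[OF qf]
      by (rule BotE, rule mp_assm[of "Neg (Or p q)"], simp, rule Assm, simp)
    show "derives T [Or p q, Neg (Neg (Or p q))] (Or p q)" by (rule Assm) simp
  qed (use qf in simp)
  then show "T \<turnstile> Imp (Neg (Neg (Or p q))) (Or p q)" by (rule ImpI)
qed

text \<open>Stability of single formulas comes first, by conservation. A disjunction then inherits
  stability from its equivalent in \<open>Pi_fm (Suc m)\<close>.\<close>

lemma PNFT_imp_DNE:
  assumes T: "in_between HA PA T"
  shows "(\<forall>k'\<le>k. PNFT T (U_class k') (Pi_fm k')) \<Longrightarrow> DNE_at T k"
proof (induction k)
  case 0
  show ?case by (rule DNE_qf[OF decides_0]) (use T in \<open>simp add: in_between_def\<close>)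
next
  case (Suc m)
  have HA: "\<forall>p. HA \<turnstile> p \<longrightarrow> T \<turnstile> p" and PA: "\<forall>p. T \<turnstile> p \<longrightarrow> PA \<turnstile> p"
    using T unfolding in_between_def by (rule conjunct1, rule conjunct2)
  have dec0: "decides T 0" by (rule decides_0[OF HA])
  have "DNE_at T m" using Suc by simp
  \<comment> \<open>DNE at level \<open>m\<close> decides the level \<open>m - 1\<close>, which is
    what \<open>conservation\<close> asks for at \<open>Suc m\<close>; so the induction
    closes.\<close>
  then have dec: "decides T j" if "m = Suc j" for j
    using decides_DNE[of T j] dec0 that by simp
  have PNFT: "\<exists>q\<in>Pi_fm (Suc m). fm_equiv T p q" if "p \<in> U_class (Suc m)" for p
    using Suc.prems that unfolding PNFT_def fm_equiv_def by blast
  have stable: "T \<turnstile> Imp (Neg (Neg p)) p" if p: "p \<in> Pi_fm (Suc m)" for p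
  proof -
    obtain p0 where p0: "p0 \<in> Pi_fm (Suc m)" "fm_equiv T p p0" "Alt p0 = {alternating Minus (Suc m)}"
      using prenex_padding(2)[OF p] unfolding equiv_in_def by blast
    \<comment> \<open>Negating twice dualises the path twice, so the single path of
      \<open>p0\<close> is also that of \<open>Neg (Neg p0)\<close>.\<close>
    have "Neg (Neg p0) \<in> U_class (Suc m)"
      by (rule alternating_U_class) (simp add: p0(3) image_image)
    then obtain q where q: "q \<in> Pi_fm (Suc m)" "fm_equiv T (Neg (Neg p0)) q"
      using PNFT by blast
    \<comment> \<open>\<open>q\<close> implies \<open>Neg (Neg p0)\<close> in \<open>T\<close>,
      hence in PA, where excluded middle for \<open>p0\<close> removes the double negation.\<close>
    have "derives PA [q] p0"
    proof (rule OrE)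
      show "derives PA [q] (Or p0 (Neg p0))" by (rule Axiom) (auto simp: PA_def)
      have "T \<turnstile> Imp q (Neg (Neg p0))" by (rule fm_equivD(3)[OF q(2)])
      then have nn: "PA \<turnstile> Imp q (Neg (Neg p0))" by (rule PA[rule_format])
      have "derives PA [Neg p0, q] (Neg (Neg p0))"
        by (rule use_theorem[OF nn]) (rule Assm, simp)
      then have "derives PA [Neg p0, q] Bot" by (rule ImpE) (rule Assm, simp)
      then show "derives PA [Neg p0, q] p0" by (rule BotE)
    qed simp
    then have "PA \<turnstile> Imp q p0" by (rule ImpI)
    then have "T \<turnstile> Imp q p0" by - (rule conservation[OF HA dec0 dec p0(1) q(1)])
    then have "derives T [Neg (Neg p0)] p0"
      by (rule use_theorem) (rule use_theorem[OF fm_equivD(2)[OF q(2)]], rule Assm, simp)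
    then have *: "T \<turnstile> Imp (Neg (Neg p0)) p0" by (rule ImpI)
    have nn: "fm_equiv T (Neg (Neg p)) (Neg (Neg p0))"
      by (intro fm_equiv_Imp p0(2) fm_equiv_refl)
    have "derives T [Neg (Neg p)] p"
      by (rule use_theorem[OF fm_equivD(3)[OF p0(2)]], rule use_theorem[OF *],
          rule use_theorem[OF fm_equivD(2)[OF nn]], rule Assm) simp
    then show ?thesis by (rule ImpI)
  qed
  show ?case
    unfolding DNE_at_def
  proof (intro ballI)
    fix p q assume p: "p \<in> Pi_fm (Suc m)" and q: "q \<in> Pi_fm (Suc m)"
    obtain p0 where p0: "fm_equiv T p p0" "Alt p0 = {alternating Minus (Suc m)}"
      using prenex_padding(2)[OF p] unfolding equiv_in_def by blast
    obtain q0 where q0: "fm_equiv T q q0" "Alt q0 = {alternating Minus (Suc m)}"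
      using prenex_padding(2)[OF q] unfolding equiv_in_def by blast
    \<comment> \<open>Both padded formulas have the same single path, so their disjunction has it
      too.\<close>
    have "Or p0 q0 \<in> U_class (Suc m)"
      by (rule alternating_U_class) (simp add: p0 q0)
    then obtain r where r: "r \<in> Pi_fm (Suc m)" "fm_equiv T (Or p0 q0) r" using PNFT by blast
    have eq: "fm_equiv T (Or p q) r"
      by (rule fm_equiv_trans[OF fm_equiv_Or[OF p0(1) q0(1)] r(2)])
    have nn: "fm_equiv T (Neg (Neg (Or p q))) (Neg (Neg r))"
      by (intro fm_equiv_Imp eq fm_equiv_refl)
    have "derives T [Neg (Neg (Or p q))] (Or p q)"
      by (rule use_theorem[OF fm_equivD(3)[OF eq]], rule use_theorem[OF stable[OF r(1)]],
          rule use_theorem[OF fm_equivD(2)[OF nn]], rule Assm) simp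
    then show "T \<turnstile> Imp (Neg (Neg (Or p q))) (Or p q)" by (rule ImpI)
  qed
qed

theorem theorem7p4:
  fixes T :: "fm set" and k :: nat
  assumes "in_between HA PA T"
  shows "T \<tturnstile> DNE_Or (Pi_fm k) (Pi_fm k) \<longleftrightarrow>
    (\<forall>k'\<le>k. PNFT T (U_class k') (Pi_fm k'))"
proof -
  have HA: "\<forall>p. HA \<turnstile> p \<longrightarrow> T \<turnstile> p" using assms unfolding in_between_def by (rule conjunct1)
  have "PNFT T (U_class k') (Pi_fm k')" if "DNE_at T k" "k' \<le> k" for k'
    unfolding PNFT_def
  proof
    fix p assume "p \<in> U_class k'"
    then have "equiv_in T (Pi_fm k') p"
      using prenex_normal_form[OF that(1) decides_0[OF HA] that(2)] U_class_below by blast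
    then show "\<exists>p'\<in>Pi_fm k'. FV p = FV p' \<and> T \<turnstile> Iff p p'"
      unfolding equiv_in_def fm_equiv_def .
  qed
  then show ?thesis using DNE_at_iff[OF HA] PNFT_imp_DNE[OF assms] by blast
qed

end
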